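(* Let $\mathcal{L}$ be the centerless twisted $N=2$ superconformal algebra over $\mathbb{C}$, with Lie bracket $\varphi=[\cdot,\cdot]$. Every Lie super-bialgebra structure on $\mathcal{L}$ is triangular coboundary. That is, for every linear map $\Delta:\mathcal{L}\to\mathcal{L}\otimes\mathcal{L}$ such that $(\mathcal{L},[\cdot,\cdot],\Delta)$ is a Lie super-bialgebra, there exists $r\in\mathrm{Im}(\mathbf{1}\otimes\mathbf{1}-\tau)\subset\mathcal{L}\otimes\mathcal{L}$ such that $\Delta=\Delta_r$, where $\Delta_r(x)=(-1)^{[r][x]}x\ast r$ for all $x\in\mathcal{L}$, and such that $r$ satisfies the classical Yang-Baxter equation $c(r)=0$.
   Context: All spaces are over $\mathbb{C}$. Tensor products are algebraic (finite sums). For a $\mathbb{Z}_2$-graded space, $[x]\in\mathbb{Z}_2$ denotes the degree of a homogeneous element $x$; whenever $[x]$ occurs, $x$ is taken homogeneous and formulas are extended linearly. **The algebra.** The centerless twisted $N=2$ superconformal algebra $\mathcal{L}$ is the Lie superalgebra with basis $\{L_m, T_r, G_p \mid m\in\mathbb{Z},\ r\in\frac12+\mathbb{Z},\ p\in\frac12\mathbb{Z}\}$, even part $\mathcal{L}_{\bar0}=\mathrm{span}\{L_m,T_r\}$, odd part $\mathcal{L}_{\bar1}=\mathrm{span}\{G_p\}$, and brackets (for $m,n\in\mathbb{Z}$, $r,s\in\frac12+\mathbb{Z}$, $p,q\in\frac12\mathbb{Z}$) $$[L_m,L_n]=(m-n)L_{m+n},\quad [L_m,T_r]=-rT_{r+m},\quad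 [T_r,T_s]=0,$$ $$[L_m,G_p]=\left(\tfrac m2-p\right)G_{p+m},\quad [T_r,G_p]=G_{p+r},$$ $$[G_p,G_q]=(-1)^{2p}\,2L_{p+q}\ \text{ if } p+q\in\mathbb{Z},\qquad [G_p,G_q]=(-1)^{2p+1}(p-q)T_{p+q}\ \text{ if } p+q\in\tfrac12+\mathbb{Z}.$$ **Maps.** $\mathbf{1}$ is the identity map of $\mathcal{L}$. The super-twist is $\tau(x\otimes y)=(-1)^{[x][y]}y\otimes x$. The super-cyclic map on $\mathcal{L}^{\otimes3}$ is $\xi(x_1\otimes x_2\otimes x_3)=(-1)^{[x_1]([x_2]+[x_3])}x_2\otimes x_3\otimes x_1$. The adjoint diagonal action of $\mathcal{L}$ on $\mathcal{L}\otimes\mathcal{L}$ is $$x\ast\Big(\sum_i a_i\otimes b_i\Big)=\sum_i\big([x,a_i]\otimes b_i+(-1)^{[x][a_i]}a_i\otimes[x,b_i]\big).$$ **Lie super-coalgebra.** A pair $(\mathcal{L},\Delta)$ with $\mathcal{L}=\mathcal{L}_{\bar0}\oplus\mathcal{L}_{\bar1}$ and $\Delta:\mathcal{L}\to\mathcal{L}\otimes\mathcal{L}$ linear such that $\Delta(\mathcal{L}_{\bar i})\subset\sum_{\bar j\in\mathbb{Z}_2}\mathcal{L}_{\bar j}\otimes\mathcal{L}_{\bar i-\bar j}$, $\mathrm{Im}\,\Delta\subset\mathrm{Im}(\mathbf{1}\otimes\mathbf{1}-\tau)$, and $(\mathbf{1}\otimes\mathbf{1}\otimes\mathbf{1}+\xi+\xi^2)\cdot(\mathbf{1}\otimes\Delta)\cdot\Delta=0$.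 **Lie super-bialgebra.** A triple $(\mathcal{L},\varphi,\Delta)$ such that $(\mathcal{L},\varphi)$ is a Lie superalgebra (with $[x,y]=\varphi(x\otimes y)$), $(\mathcal{L},\Delta)$ is a Lie super-coalgebra, and $\Delta([x,y])=x\ast\Delta y-(-1)^{[x][y]}y\ast\Delta x$ for all $x,y\in\mathcal{L}$. A Lie super-bialgebra structure on the Lie superalgebra $\mathcal{L}$ is a $\Delta$ making $(\mathcal{L},[\cdot,\cdot],\Delta)$ a Lie super-bialgebra. **Classical Yang-Baxter expression.** For $r=\sum_i a_i\otimes b_i$ with $a_i,b_i$ homogeneous, $c(r)=[r^{12},r^{13}]+[r^{12},r^{23}]+[r^{13},r^{23}]\in\mathcal{L}^{\otimes3}$, where $$[r^{12},r^{23}]=\sum_{i,j}a_i\otimes[b_i,a_j]\otimes b_j,\quad [r^{12},r^{13}]=\sum_{i,j}(-1)^{[a_j][b_i]}[a_i,a_j]\otimes b_i\otimes b_j,\quad [r^{13},r^{23}]=\sum_{i,j}(-1)^{[a_j][b_i]}a_i\otimes a_j\otimes[b_i,b_j].$$ *)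

theory Defs
  imports Complex_Main "HOL-Library.Poly_Mapping" "HOL-Library.Z2"
begin

section \<open>Super vector spaces with a homogeneous basis\<close>

text \<open>
  A complex vector space with a basis indexed by \<open>'b\<close> is represented by the finitely supported
  functions \<open>'b \<Rightarrow>\<^sub>0 complex\<close>. A grading by \<open>\<int>/2\<close> (the type \<^typ>\<open>bit\<close>) is given by a parity function
  on the basis. The algebraic tensor product of the spaces with bases \<open>'b\<close> and \<open>'c\<close> is the space
  with basis \<open>'b \<times> 'c\<close>; triple tensors are associated to the right.
  The multiplication that \<^theory>\<open>HOL-Library.Poly_Mapping\<close> puts on \<open>'b \<Rightarrow>\<^sub>0 complex\<close> is not used.
\<close>

type_synonym 'b vec = "'b \<Rightarrow>\<^sub>0 complex"

definition scale :: "complex \<Rightarrow> 'b vec \<Rightarrow> 'b vec" where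
  "scale c x = Poly_Mapping.map ((*) c) x"

definition basis :: "'b \<Rightarrow> 'b vec" where
  "basis b = Poly_Mapping.single b 1"

text \<open>The linear map with prescribed values \<open>f\<close> on the basis.\<close>

definition lin :: "('b \<Rightarrow> 'c vec) \<Rightarrow> 'b vec \<Rightarrow> 'c vec" where
  "lin f x = (\<Sum>b\<in>Poly_Mapping.keys x. scale (Poly_Mapping.lookup x b) (f b))"

definition tens :: "'b vec \<Rightarrow> 'c vec \<Rightarrow> ('b \<times> 'c) vec" (infixr "\<otimes>" 70) where
  "x \<otimes> y = lin (\<lambda>b. lin (\<lambda>c. basis (b, c)) y) x"

definition tensor_map :: "('a vec \<Rightarrow> 'c vec) \<Rightarrow> ('b vec \<Rightarrow> 'd vec) \<Rightarrow> ('a \<times> 'b) vec \<Rightarrow> ('c \<times> 'd) vec" where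
  "tensor_map f g = lin (\<lambda>(a, b). f (basis a) \<otimes> g (basis b))"

definition homog :: "('b \<Rightarrow> bit) \<Rightarrow> bit \<Rightarrow> 'b vec set" where
  "homog par i = {x. \<forall>b\<in>Poly_Mapping.keys x. par b = i}"

definition tensor_parity :: "('b \<Rightarrow> bit) \<Rightarrow> ('c \<Rightarrow> bit) \<Rightarrow> 'b \<times> 'c \<Rightarrow> bit" where
  "tensor_parity par par' = (\<lambda>(b, c). par b + par' c)"

definition zsign :: "bit \<Rightarrow> complex" where
  "zsign i = (if i = 1 then -1 else 1)"

definition linear_map :: "('b vec \<Rightarrow> 'c vec) \<Rightarrow> bool" where
  "linear_map f \<longleftrightarrow> Vector_Spaces.linear scale scale f"

definition bilinear_map :: "('a vec \<Rightarrow> 'b vec \<Rightarrow> 'c vec) \<Rightarrow> bool" where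
  "bilinear_map f \<longleftrightarrow> (\<forall>x. linear_map (f x)) \<and> (\<forall>y. linear_map (\<lambda>x. f x y))"


section \<open>Lie super-bialgebras\<close>

definition lie_superalgebra :: "('b \<Rightarrow> bit) \<Rightarrow> ('b vec \<Rightarrow> 'b vec \<Rightarrow> 'b vec) \<Rightarrow> bool" where
  "lie_superalgebra par br \<longleftrightarrow>
     bilinear_map br \<and>
     (\<forall>i j. \<forall>x\<in>homog par i. \<forall>y\<in>homog par j. br x y \<in> homog par (i + j)) \<and>
     (\<forall>i j. \<forall>x\<in>homog par i. \<forall>y\<in>homog par j. br x y = - scale (zsign (i * j)) (br y x)) \<and>
     (\<forall>i j k. \<forall>x\<in>homog par i. \<forall>y\<in>homog par j. \<forall>z\<in>homog par k.
        br x (br y z) = br (br x y) z + scale (zsign (i * j)) (br y (br x z)))"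

definition super_twist :: "('b \<Rightarrow> bit) \<Rightarrow> ('b \<times> 'b) vec \<Rightarrow> ('b \<times> 'b) vec" where
  "super_twist par = lin (\<lambda>(a, b). scale (zsign (par a * par b)) (basis b \<otimes> basis a))"

definition super_cyclic :: "('b \<Rightarrow> bit) \<Rightarrow> ('b \<times> 'b \<times> 'b) vec \<Rightarrow> ('b \<times> 'b \<times> 'b) vec" where
  "super_cyclic par = lin (\<lambda>(a, b, c).
     scale (zsign (par a * (par b + par c))) (basis b \<otimes> basis c \<otimes> basis a))"

text \<open>The image of \<open>1 \<otimes> 1 - \<tau>\<close>.\<close>

definition skew_tensors :: "('b \<Rightarrow> bit) \<Rightarrow> ('b \<times> 'b) vec set" where
  "skew_tensors par = range (\<lambda>t. t - super_twist par t)"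

definition adj_act :: "('b \<Rightarrow> bit) \<Rightarrow> ('b vec \<Rightarrow> 'b vec \<Rightarrow> 'b vec) \<Rightarrow>
    'b vec \<Rightarrow> ('b \<times> 'b) vec \<Rightarrow> ('b \<times> 'b) vec" where
  "adj_act par br x t = lin (\<lambda>c. lin (\<lambda>(a, b).
     br (basis c) (basis a) \<otimes> basis b
     + scale (zsign (par c * par a)) (basis a \<otimes> br (basis c) (basis b))) t) x"

definition lie_super_coalgebra :: "('b \<Rightarrow> bit) \<Rightarrow> ('b vec \<Rightarrow> ('b \<times> 'b) vec) \<Rightarrow> bool" where
  "lie_super_coalgebra par \<Delta> \<longleftrightarrow>
     linear_map \<Delta> \<and>
     (\<forall>i. \<Delta> ` homog par i \<subseteq> homog (tensor_parity par par) i) \<and>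
     range \<Delta> \<subseteq> skew_tensors par \<and>
     (\<forall>x. let u = tensor_map id \<Delta> (\<Delta> x) in
        u + super_cyclic par u + super_cyclic par (super_cyclic par u) = 0)"

definition lie_super_bialgebra :: "('b \<Rightarrow> bit) \<Rightarrow> ('b vec \<Rightarrow> 'b vec \<Rightarrow> 'b vec) \<Rightarrow>
    ('b vec \<Rightarrow> ('b \<times> 'b) vec) \<Rightarrow> bool" where
  "lie_super_bialgebra par br \<Delta> \<longleftrightarrow>
     lie_superalgebra par br \<and>
     lie_super_coalgebra par \<Delta> \<and>
     (\<forall>i j. \<forall>x\<in>homog par i. \<forall>y\<in>homog par j.
        \<Delta> (br x y) = adj_act par br x (\<Delta> y) - scale (zsign (i * j)) (adj_act par br y (\<Delta> x)))"

text \<open>\<open>\<Delta>\<^sub>r(x) = (-1)\<^bsup>[r][x]\<^esup> x * r\<close>, extended bilinearly in \<open>r\<close> and \<open>x\<close>.\<close>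

definition coboundary :: "('b \<Rightarrow> bit) \<Rightarrow> ('b vec \<Rightarrow> 'b vec \<Rightarrow> 'b vec) \<Rightarrow>
    ('b \<times> 'b) vec \<Rightarrow> 'b vec \<Rightarrow> ('b \<times> 'b) vec" where
  "coboundary par br r x = lin (\<lambda>c. lin (\<lambda>d.
     scale (zsign (tensor_parity par par d * par c)) (adj_act par br (basis c) (basis d))) r) x"

text \<open>
  The three parts of the classical Yang--Baxter expression are written for the expansion of \<open>r\<close>
  in the basis tensors; lemma \<open>cybe_decomposition\<close> gives the formula for any homogeneous
  decomposition.
\<close>

definition br_r12_r13 :: "('b \<Rightarrow> bit) \<Rightarrow> ('b vec \<Rightarrow> 'b vec \<Rightarrow> 'b vec) \<Rightarrow>
    ('b \<times> 'b) vec \<Rightarrow> ('b \<times> 'b \<times> 'b) vec" where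
  "br_r12_r13 par br r = lin (\<lambda>(a, b). lin (\<lambda>(a', b').
     scale (zsign (par a' * par b)) (br (basis a) (basis a') \<otimes> basis b \<otimes> basis b')) r) r"

definition br_r12_r23 :: "('b \<Rightarrow> bit) \<Rightarrow> ('b vec \<Rightarrow> 'b vec \<Rightarrow> 'b vec) \<Rightarrow>
    ('b \<times> 'b) vec \<Rightarrow> ('b \<times> 'b \<times> 'b) vec" where
  "br_r12_r23 par br r = lin (\<lambda>(a, b). lin (\<lambda>(a', b').
     basis a \<otimes> br (basis b) (basis a') \<otimes> basis b') r) r"

definition br_r13_r23 :: "('b \<Rightarrow> bit) \<Rightarrow> ('b vec \<Rightarrow> 'b vec \<Rightarrow> 'b vec) \<Rightarrow>
    ('b \<times> 'b) vec \<Rightarrow> ('b \<times> 'b \<times> 'b) vec" where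
  "br_r13_r23 par br r = lin (\<lambda>(a, b). lin (\<lambda>(a', b').
     scale (zsign (par a' * par b)) (basis a \<otimes> basis a' \<otimes> br (basis b) (basis b'))) r) r"

definition cybe :: "('b \<Rightarrow> bit) \<Rightarrow> ('b vec \<Rightarrow> 'b vec \<Rightarrow> 'b vec) \<Rightarrow>
    ('b \<times> 'b) vec \<Rightarrow> ('b \<times> 'b \<times> 'b) vec" where
  "cybe par br r = br_r12_r13 par br r + br_r12_r23 par br r + br_r13_r23 par br r"


section \<open>The centerless twisted \<open>N = 2\<close> superconformal algebra\<close>

text \<open>
  Half-integer indices are encoded by integers: \<open>L m\<close> is \<open>L\<^sub>m\<close>, \<open>T k\<close> is \<open>T\<^sub>r\<close> with \<open>r = k + 1/2\<close>,
  and \<open>G a\<close> is \<open>G\<^sub>p\<close> with \<open>p = a/2\<close>.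
\<close>

datatype tn2_index = L int | T int | G int

fun tn2_parity :: "tn2_index \<Rightarrow> bit" where
  "tn2_parity (L m) = 0"
| "tn2_parity (T k) = 0"
| "tn2_parity (G a) = 1"

text \<open>
  In the last equation \<open>p + q\<close> is an integer iff \<open>a + b\<close> is even, and otherwise
  \<open>p + q = k + 1/2\<close> with \<open>k = (a + b - 1)/2\<close>, which is \<open>(a + b) div 2\<close> as well.
\<close>

fun tn2_basis_bracket :: "tn2_index \<Rightarrow> tn2_index \<Rightarrow> tn2_index vec" where
  "tn2_basis_bracket (L m) (L n) = scale (of_int (m - n)) (basis (L (m + n)))"
| "tn2_basis_bracket (L m) (T k) = scale (- (of_int k + 1/2)) (basis (T (k + m)))"
| "tn2_basis_bracket (T k) (L m) = scale (of_int k + 1/2) (basis (T (k + m)))"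
| "tn2_basis_bracket (T k) (T l) = 0"
| "tn2_basis_bracket (L m) (G a) = scale (of_int m / 2 - of_int a / 2) (basis (G (a + 2 * m)))"
| "tn2_basis_bracket (G a) (L m) = scale (- (of_int m / 2 - of_int a / 2)) (basis (G (a + 2 * m)))"
| "tn2_basis_bracket (T k) (G a) = basis (G (a + (2 * k + 1)))"
| "tn2_basis_bracket (G a) (T k) = - basis (G (a + (2 * k + 1)))"
| "tn2_basis_bracket (G a) (G b) =
     (if even (a + b) then scale ((-1) powi a * 2) (basis (L ((a + b) div 2)))
      else scale ((-1) powi (a + 1) * (of_int a / 2 - of_int b / 2)) (basis (T ((a + b) div 2))))"

definition tn2_bracket :: "tn2_index vec \<Rightarrow> tn2_index vec \<Rightarrow> tn2_index vec" where
  "tn2_bracket x y = lin (\<lambda>a. lin (\<lambda>b. tn2_basis_bracket a b) y) x"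


section \<open>Basic facts\<close>

lemma lookup_scale [simp]: "Poly_Mapping.lookup (scale c x) b = c * Poly_Mapping.lookup x b"
  by (simp add: scale_def Poly_Mapping.map.rep_eq when_def)

lemma vector_space_scale: "vector_space scale"
  by unfold_locales (auto intro!: poly_mapping_eqI simp: lookup_add algebra_simps)

interpretation vec: vector_space scale
  by (rule vector_space_scale)

lemma linear_map_iff:
  "linear_map f \<longleftrightarrow> (\<forall>x y. f (x + y) = f x + f y) \<and> (\<forall>c x. f (scale c x) = scale c (f x))"
  by (auto simp: linear_map_def Vector_Spaces.linear_iff vector_space_scale)

lemma lin_superset:
  assumes "finite B" "Poly_Mapping.keys x \<subseteq> B"
  shows "lin f x = (\<Sum>b\<in>B. scale (Poly_Mapping.lookup x b) (f b))"
  unfolding lin_def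
  by (rule sum.mono_neutral_left) (use assms in \<open>auto simp: in_keys_iff\<close>)

lemma lin_add [simp]: "lin f (x + y) = lin f x + lin f y"
proof -
  let ?B = "Poly_Mapping.keys x \<union> Poly_Mapping.keys y"
  have "lin f (x + y) = (\<Sum>b\<in>?B. scale (Poly_Mapping.lookup (x + y) b) (f b))"
    by (rule lin_superset) (use keys_add[of x y] in auto)
  moreover have "lin f x = (\<Sum>b\<in>?B. scale (Poly_Mapping.lookup x b) (f b))"
    by (rule lin_superset) auto
  moreover have "lin f y = (\<Sum>b\<in>?B. scale (Poly_Mapping.lookup y b) (f b))"
    by (rule lin_superset) auto
  ultimately show ?thesis
    by (simp add: lookup_add vec.scale_left_distrib sum.distrib)
qed

lemma keys_scale: "Poly_Mapping.keys (scale c x) \<subseteq> Poly_Mapping.keys x"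
  by (auto simp: in_keys_iff)

lemma lin_scale [simp]: "lin f (scale c x) = scale c (lin f x)"
proof -
  have "lin f (scale c x) = (\<Sum>b\<in>Poly_Mapping.keys x. scale (Poly_Mapping.lookup (scale c x) b) (f b))"
    by (rule lin_superset) (simp_all add: keys_scale)
  then show ?thesis
    by (simp add: lin_def vec.scale_sum_right)
qed

lemma lin_zero [simp]: "lin f 0 = 0"
  by (simp add: lin_def)

lemma lin_basis [simp]: "lin f (basis b) = f b"
  by (simp add: lin_def basis_def)

lemma linear_map_lin: "linear_map (lin f)"
  by (simp add: linear_map_iff)

lemma lin_fun_add [simp]: "lin (\<lambda>b. f b + g b) x = lin f x + lin g x"
  by (simp add: lin_def vec.scale_right_distrib sum.distrib)

lemma lin_fun_scale [simp]: "lin (\<lambda>b. scale c (f b)) x = scale c (lin f x)"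
  by (simp add: lin_def vec.scale_sum_right mult.commute)

lemma lin_fun_zero [simp]: "lin (\<lambda>b. 0) x = 0"
  by (simp add: lin_def)

lemma tens_simps [simp]:
  "(x + y) \<otimes> z = x \<otimes> z + y \<otimes> z"
  "z \<otimes> (x + y) = z \<otimes> x + z \<otimes> y"
  "scale c x \<otimes> z = scale c (x \<otimes> z)"
  "z \<otimes> scale c x = scale c (z \<otimes> x)"
  "0 \<otimes> z = 0" "z \<otimes> 0 = 0"
  "basis a \<otimes> basis b = basis (a, b)"
  by (simp_all add: tens_def)

lemma homog_subspace:
  "0 \<in> homog par i"
  "x \<in> homog par i \<Longrightarrow> y \<in> homog par i \<Longrightarrow> x + y \<in> homog par i"
  "x \<in> homog par i \<Longrightarrow> scale c x \<in> homog par i"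
  using keys_add[of x y] keys_scale[of c x] by (auto simp: homog_def)

lemma basis_homog: "basis b \<in> homog par (par b)"
  by (simp add: homog_def basis_def)

lemma expansion: "x = (\<Sum>b\<in>Poly_Mapping.keys x. scale (Poly_Mapping.lookup x b) (basis b))"
proof (rule poly_mapping_eqI)
  fix k
  have "(\<Sum>b\<in>Poly_Mapping.keys x. Poly_Mapping.lookup x b * Poly_Mapping.lookup (basis b) k)
      = (\<Sum>b\<in>Poly_Mapping.keys x. if b = k then Poly_Mapping.lookup x k else 0)"
    by (rule sum.cong) (auto simp: basis_def lookup_single when_def)
  then show "Poly_Mapping.lookup x k = Poly_Mapping.lookup (\<Sum>b\<in>Poly_Mapping.keys x. scale (Poly_Mapping.lookup x b) (basis b)) k"
    by (simp add: lookup_sum in_keys_iff)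
qed

lemma homog_induct [consumes 1, case_names zero add scale]:
  assumes "x \<in> homog par i"
    and "P 0" and "\<And>x y. P x \<Longrightarrow> P y \<Longrightarrow> P (x + y)"
    and "\<And>c b. par b = i \<Longrightarrow> P (scale c (basis b))"
  shows "P x"
proof -
  have "P (\<Sum>b\<in>B. scale (Poly_Mapping.lookup x b) (basis b))" if "finite B" "B \<subseteq> Poly_Mapping.keys x" for B
    using that
  proof (induction B rule: finite_induct)
    case (insert b B)
    then have "par b = i"
      using assms(1) by (auto simp: homog_def)
    with insert show ?case
      by (auto intro!: assms(3,4))
  qed (simp add: assms(2))
  from this[of "Poly_Mapping.keys x"] show ?thesis
    using expansion[of x] by simp
qed

lemma vec_induct [case_names zero add scale]:
  assumes "P 0" "\<And>x y. P x \<Longrightarrow> P y \<Longrightarrow> P (x + y)" "\<And>c b. P (scale c (basis b))"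
  shows "P x"
proof -
  have "x \<in> homog (\<lambda>_. 0) 0"
    by (simp add: homog_def)
  then show ?thesis
    by (induction rule: homog_induct) (use assms in auto)
qed

lemma tens_homog:
  assumes "x \<in> homog par i" "y \<in> homog par' j"
  shows "x \<otimes> y \<in> homog (tensor_parity par par') (i + j)"
  using assms(1)
proof (induction rule: homog_induct)
  case (scale c b)
  from assms(2) have "basis b \<otimes> y \<in> homog (tensor_parity par par') (i + j)"
  proof (induction rule: homog_induct)
    case (scale d e)
    have "basis (b, e) \<in> homog (tensor_parity par par') (i + j)"
      using basis_homog[of "(b, e)" "tensor_parity par par'"] scale \<open>par b = i\<close>
      by (simp add: tensor_parity_def)
    then show ?case by (simp add: homog_subspace)
  qed (simp_all add: homog_subspace)
  then show ?case by (simp add: homog_subspace)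
qed (simp_all add: homog_subspace)

text \<open>The grading on tensors given by \<^const>\<open>tensor_parity\<close> is \<open>\<Sum>\<^sub>j V\<^sub>j \<otimes> W\<^bsub>i-j\<^esub>\<close>.\<close>

lemma homog_tensor_eq_span:
  "homog (tensor_parity par par') i =
     vec.span {x \<otimes> y | x y. \<exists>j. x \<in> homog par j \<and> y \<in> homog par' (i - j)}" (is "_ = vec.span ?S")
proof (intro equalityI subsetI)
  fix t assume "t \<in> homog (tensor_parity par par') i"
  then show "t \<in> vec.span ?S"
  proof (induction rule: homog_induct)
    case (scale c b)
    obtain b1 b2 where b: "b = (b1, b2)" by force
    have "par' b2 = i - par b1"
      using scale b by (auto simp: tensor_parity_def)
    then have "basis b1 \<otimes> basis b2 \<in> ?S"
      using basis_homog[of b1 par] basis_homog[of b2 par'] by (metis (mono_tags, lifting) mem_Collect_eq)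
    then show ?case
      unfolding b tens_simps by (intro vec.span_scale vec.span_base)
  qed (blast intro: vec.span_zero vec.span_add)+
next
  fix t assume "t \<in> vec.span ?S"
  then show "t \<in> homog (tensor_parity par par') i"
  proof (induction rule: vec.span_induct_alt)
    case (step c x y)
    then obtain u v j where "x = u \<otimes> v" "u \<in> homog par j" "v \<in> homog par' (i - j)"
      by auto
    moreover have "j + (i - j) = i" by (cases i; cases j) auto
    ultimately have "x \<in> homog (tensor_parity par par') i"
      using tens_homog[of u par j v par' "i - j"] by auto
    with step show ?case by (simp add: homog_subspace)
  qed (simp add: homog_subspace)
qed

lemma tensor_map_tens:
  assumes "linear_map f" "linear_map g"
  shows "tensor_map f g (x \<otimes> y) = f x \<otimes> g y"
proof -
  note lin' = assms[unfolded linear_map_iff]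
  have 0: "f 0 = 0" "g 0 = 0"
    using lin' by (metis vec.scale_zero_left)+
  show ?thesis
  proof (induction x rule: vec_induct)
    case (scale c b)
    have "tensor_map f g (basis b \<otimes> y) = f (basis b) \<otimes> g y"
      by (induction y rule: vec_induct) (simp_all add: tensor_map_def lin' 0)
    then show ?case by (simp add: tensor_map_def lin')
  qed (simp_all add: tensor_map_def lin' 0)
qed

lemma super_twist_tens:
  assumes "x \<in> homog par i" "y \<in> homog par j"
  shows "super_twist par (x \<otimes> y) = scale (zsign (i * j)) (y \<otimes> x)"
  using assms(1)
proof (induction rule: homog_induct)
  case (scale c b)
  from assms(2) have "super_twist par (basis b \<otimes> y) = scale (zsign (i * j)) (y \<otimes> basis b)"
    by (induction rule: homog_induct)
      (simp_all add: super_twist_def scale vec.scale_right_distrib mult.commute)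
  then show ?case by (simp add: super_twist_def mult.commute)
qed (simp_all add: super_twist_def vec.scale_right_distrib)

lemma super_cyclic_tens:
  assumes "x \<in> homog par i" "y \<in> homog par j" "z \<in> homog par k"
  shows "super_cyclic par (x \<otimes> y \<otimes> z) = scale (zsign (i * (j + k))) (y \<otimes> z \<otimes> x)"
  using assms(1)
proof (induction rule: homog_induct)
  case (scale c b)
  note b = scale
  from assms(2)
  have "super_cyclic par (basis b \<otimes> y \<otimes> z) = scale (zsign (i * (j + k))) (y \<otimes> z \<otimes> basis b)"
  proof (induction rule: homog_induct)
    case (scale d e)
    from assms(3) have "super_cyclic par (basis b \<otimes> basis e \<otimes> z)
        = scale (zsign (i * (j + k))) (basis e \<otimes> z \<otimes> basis b)"
      by (induction rule: homog_induct)
        (simp_all add: super_cyclic_def scale b vec.scale_right_distrib mult.commute)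
    then show ?case by (simp add: super_cyclic_def mult.commute)
  qed (simp_all add: super_cyclic_def vec.scale_right_distrib)
  then show ?case by (simp add: super_cyclic_def mult.commute)
qed (simp_all add: super_cyclic_def vec.scale_right_distrib)

context
  fixes par :: "'b \<Rightarrow> bit" and br :: "'b vec \<Rightarrow> 'b vec \<Rightarrow> 'b vec"
  assumes bil: "bilinear_map br"
begin

lemma br_simps:
  "br (x + y) z = br x z + br y z" "br z (x + y) = br z x + br z y"
  "br (scale c x) z = scale c (br x z)" "br z (scale c x) = scale c (br z x)"
  "br 0 z = 0" "br z 0 = 0"
proof -
  show *: "br (x + y) z = br x z + br y z" "br z (x + y) = br z x + br z y"
    "br (scale c x) z = scale c (br x z)" "br z (scale c x) = scale c (br z x)" for x y z c
    using bil by (auto simp: bilinear_map_def linear_map_iff)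
  show "br 0 z = 0" "br z 0 = 0"
    using *(3)[of 0 0 z] *(4)[of z 0 0] by simp_all
qed

lemma adj_act_simps:
  "adj_act par br (x + y) t = adj_act par br x t + adj_act par br y t"
  "adj_act par br (scale c x) t = scale c (adj_act par br x t)"
  "adj_act par br x (t + u) = adj_act par br x t + adj_act par br x u"
  "adj_act par br x (scale c t) = scale c (adj_act par br x t)"
  "adj_act par br 0 t = 0" "adj_act par br x 0 = 0"
  by (simp_all add: adj_act_def)

lemma adj_act_tens:
  assumes "x \<in> homog par i" "a \<in> homog par j"
  shows "adj_act par br x (a \<otimes> b) = br x a \<otimes> b + scale (zsign (i * j)) (a \<otimes> br x b)"
  using assms(1)
proof (induction rule: homog_induct)
  case (scale c e)
  note e = scale
  from assms(2) have "adj_act par br (basis e) (a \<otimes> b)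
      = br (basis e) a \<otimes> b + scale (zsign (i * j)) (a \<otimes> br (basis e) b)"
  proof (induction rule: homog_induct)
    case (scale d f)
    have "adj_act par br (basis e) (basis f \<otimes> b)
        = br (basis e) (basis f) \<otimes> b + scale (zsign (i * j)) (basis f \<otimes> br (basis e) b)"
      by (induction b rule: vec_induct)
        (simp_all add: adj_act_def br_simps e scale vec.scale_right_distrib mult.commute)
    then show ?case
      by (simp add: adj_act_simps br_simps vec.scale_right_distrib mult.commute)
  qed (simp_all add: adj_act_simps br_simps vec.scale_right_distrib)
  then show ?case
    by (simp add: adj_act_simps br_simps vec.scale_right_distrib mult.commute)
qed (simp_all add: adj_act_simps br_simps vec.scale_right_distrib)

lemma coboundary_homog:
  assumes "r \<in> homog (tensor_parity par par) k" "x \<in> homog par i"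
  shows "coboundary par br r x = scale (zsign (k * i)) (adj_act par br x r)"
  using assms(2)
proof (induction rule: homog_induct)
  case (scale c e)
  note e = scale
  from assms(1)
  have "coboundary par br r (basis e) = scale (zsign (k * i)) (adj_act par br (basis e) r)"
    by (induction rule: homog_induct)
      (simp_all add: coboundary_def adj_act_simps e vec.scale_right_distrib mult.commute)
  then show ?case by (simp add: coboundary_def adj_act_simps mult.commute)
qed (simp_all add: coboundary_def adj_act_simps vec.scale_right_distrib)

end

lemma lin_tens: "lin f (x \<otimes> y) = lin (\<lambda>a. lin (\<lambda>b. f (a, b)) y) x"
proof (induction x rule: vec_induct)
  case (scale c b)
  have "lin f (basis b \<otimes> y) = lin (\<lambda>d. f (b, d)) y"
    by (induction y rule: vec_induct) simp_all
  then show ?case by simp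
qed simp_all

lemma lin_sum: "lin f (\<Sum>i\<in>I. x i) = (\<Sum>i\<in>I. lin f (x i))"
  by (induction I rule: infinite_finite_induct) simp_all

lemma lin_fun_sum: "lin (\<lambda>b. \<Sum>i\<in>I. f i b) x = (\<Sum>i\<in>I. lin (f i) x)"
  by (induction I rule: infinite_finite_induct) simp_all

lemma lin_eqI:
  assumes "linear_map f" "x \<in> homog par i" "\<And>b. par b = i \<Longrightarrow> h b = f (basis b)"
  shows "lin h x = f x"
proof -
  have "f 0 = 0"
    using assms(1) unfolding linear_map_iff by (metis vec.scale_zero_left)
  with assms(2) show ?thesis
    by (induction rule: homog_induct) (use assms(1,3) in \<open>simp_all add: linear_map_iff\<close>)
qed

lemma lin_eqI':
  assumes "linear_map f" "\<And>b. h b = f (basis b)"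
  shows "lin h x = f x"
  by (rule lin_eqI[of _ _ "\<lambda>_. 0" 0]) (use assms in \<open>auto simp: homog_def\<close>)

lemma cybe_decomposition:
  assumes bil: "bilinear_map br"
    and r: "r = (\<Sum>i\<in>I. a i \<otimes> b i)"
    and hom: "\<And>i. i \<in> I \<Longrightarrow> a i \<in> homog par (p i)" "\<And>i. i \<in> I \<Longrightarrow> b i \<in> homog par (q i)"
  shows "cybe par br r =
      (\<Sum>i\<in>I. \<Sum>j\<in>I. scale (zsign (p j * q i)) (br (a i) (a j) \<otimes> b i \<otimes> b j))
    + (\<Sum>i\<in>I. \<Sum>j\<in>I. a i \<otimes> br (b i) (a j) \<otimes> b j)
    + (\<Sum>i\<in>I. \<Sum>j\<in>I. scale (zsign (p j * q i)) (a i \<otimes> a j \<otimes> br (b i) (b j)))"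
proof -
  note lms = linear_map_iff br_simps[OF bil] vec.scale_right_distrib mult.commute
  have "br_r12_r13 par br r =
      (\<Sum>i\<in>I. \<Sum>j\<in>I. scale (zsign (p j * q i)) (br (a i) (a j) \<otimes> b i \<otimes> b j))"
    unfolding br_r12_r13_def r lin_sum lin_fun_sum lin_tens prod.case
    by (intro sum.cong refl lin_eqI' lin_eqI[OF _ hom(1)] lin_eqI[OF _ hom(2)]; simp add: lms)
  moreover have "br_r12_r23 par br r = (\<Sum>i\<in>I. \<Sum>j\<in>I. a i \<otimes> br (b i) (a j) \<otimes> b j)"
    unfolding br_r12_r23_def r lin_sum lin_fun_sum lin_tens prod.case
    by (intro sum.cong refl lin_eqI' lin_eqI[OF _ hom(1)] lin_eqI[OF _ hom(2)]; simp add: lms)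
  moreover have "br_r13_r23 par br r =
      (\<Sum>i\<in>I. \<Sum>j\<in>I. scale (zsign (p j * q i)) (a i \<otimes> a j \<otimes> br (b i) (b j)))"
    unfolding br_r13_r23_def r lin_sum lin_fun_sum lin_tens prod.case
    by (intro sum.cong refl lin_eqI' lin_eqI[OF _ hom(1)] lin_eqI[OF _ hom(2)]; simp add: lms)
  ultimately show ?thesis by (simp add: cybe_def)
qed

lemma bilinear_tn2_bracket: "bilinear_map tn2_bracket"
  by (simp add: bilinear_map_def linear_map_iff tn2_bracket_def)

lemma tn2_bracket_basis [simp]: "tn2_bracket (basis a) (basis b) = tn2_basis_bracket a b"
  by (simp add: tn2_bracket_def)

lemma minus_one_powi: "(-1 :: complex) powi n = (if even n then 1 else -1)"
  by (auto simp: power_int_def even_nat_iff)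

lemma basis_eq_iff [simp]: "basis a = basis b \<longleftrightarrow> a = b"
  by (metis basis_def lookup_single_eq lookup_single_not_eq zero_neq_one)

lemma tn2_basis_bracket_homog: "tn2_basis_bracket a b \<in> homog tn2_parity (tn2_parity a + tn2_parity b)"
  by (cases a; cases b)
    (auto intro!: homog_subspace simp: basis_def homog_def in_keys_iff lookup_single when_def split: if_splits)

lemma tn2_basis_bracket_skew:
  "tn2_basis_bracket a b = - scale (zsign (tn2_parity a * tn2_parity b)) (tn2_basis_bracket b a)"
  by (cases a; cases b)
    (auto intro!: poly_mapping_eqI simp: zsign_def minus_one_powi lookup_add lookup_minus add.commute field_simps)

lemma tn2_jacobi_basis:
  "tn2_bracket (basis a) (tn2_basis_bracket b c) =
     tn2_bracket (tn2_basis_bracket a b) (basis c)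
     + scale (zsign (tn2_parity a * tn2_parity b)) (tn2_bracket (basis b) (tn2_basis_bracket a c))"
proof -
  have minus: "- basis x = scale (- 1) (basis x)" for x :: tn2_index
    by simp
  note simps = br_simps[OF bilinear_tn2_bracket] zsign_def minus_one_powi minus
  have GG: "tn2_basis_bracket (G (2 * k)) (G (2 * l)) = scale 2 (basis (L (k + l)))"
    "tn2_basis_bracket (G (2 * k + 1)) (G (2 * l + 1)) = scale (- 2) (basis (L (k + l + 1)))"
    "tn2_basis_bracket (G (2 * k)) (G (2 * l + 1)) = scale (- (of_int k - of_int l - 1 / 2)) (basis (T (k + l)))"
    "tn2_basis_bracket (G (2 * k + 1)) (G (2 * l)) = scale (of_int k - of_int l + 1 / 2) (basis (T (k + l)))"
    for k l
  proof -
    have "(2 * k + 1 + (2 * l + 1)) div 2 = k + l + 1" "(2 * k + (2 * l + 1)) div 2 = k + l"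
      "(2 * k + 1 + 2 * l) div 2 = k + l" "(2 * k + 2 * l) div 2 = k + l"
      by presburger+
    then show "tn2_basis_bracket (G (2 * k)) (G (2 * l)) = scale 2 (basis (L (k + l)))"
      "tn2_basis_bracket (G (2 * k + 1)) (G (2 * l + 1)) = scale (- 2) (basis (L (k + l + 1)))"
      "tn2_basis_bracket (G (2 * k)) (G (2 * l + 1)) = scale (- (of_int k - of_int l - 1 / 2)) (basis (T (k + l)))"
      "tn2_basis_bracket (G (2 * k + 1)) (G (2 * l)) = scale (of_int k - of_int l + 1 / 2) (basis (T (k + l)))"
      by (simp_all add: minus_one_powi field_simps del: vec.scale_minus_left flip: vec.scale_minus_left)
  qed
  have LG: "tn2_basis_bracket (L m) (G (2 * k)) = scale (of_int m / 2 - of_int k) (basis (G (2 * (k + m))))"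
    "tn2_basis_bracket (L m) (G (2 * k + 1)) = scale (of_int m / 2 - of_int k - 1/2) (basis (G (2 * (k + m) + 1)))"
    "tn2_basis_bracket (G (2 * k)) (L m) = scale (- (of_int m / 2 - of_int k)) (basis (G (2 * (k + m))))"
    "tn2_basis_bracket (G (2 * k + 1)) (L m) = scale (- (of_int m / 2 - of_int k - 1/2)) (basis (G (2 * (k + m) + 1)))"
    "tn2_basis_bracket (T m) (G (2 * k)) = scale 1 (basis (G (2 * (k + m) + 1)))"
    "tn2_basis_bracket (T m) (G (2 * k + 1)) = scale 1 (basis (G (2 * (k + m + 1))))"
    "tn2_basis_bracket (G (2 * k)) (T m) = scale (- 1) (basis (G (2 * (k + m) + 1)))"
    "tn2_basis_bracket (G (2 * k + 1)) (T m) = scale (- 1) (basis (G (2 * (k + m + 1))))"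
    for k m
    by (simp_all add: field_simps)
  have idx: "P x" if "\<And>m. P (L m)" "\<And>m. P (T m)" "\<And>k. P (G (2 * k))" "\<And>k. P (G (2 * k + 1))"
    for P x
    using that by (cases x) (simp, simp, metis oddE evenE)
  have comb: "scale c1 (basis x) = scale c2 (basis y) + scale c3 (basis z)"
    if "x = y" "x = z" "c1 = c2 + c3" for c1 c2 c3 and x y z :: tn2_index
    using that by (simp add: vec.scale_left_distrib)
  have comb0: "0 = scale c2 (basis y) + scale c3 (basis z)"
    if "y = z" "c2 + c3 = 0" for c2 c3 and y z :: tn2_index
    using that by (simp flip: vec.scale_left_distrib)
  have eq: "scale c1 (basis x) = scale c2 (basis y)" if "x = y" "c1 = c2"
    for c1 c2 and x y :: tn2_index
    using that by simp
  note B = GG LG tn2_basis_bracket.simps(1-4)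
  show ?thesis
    by (induct a rule: idx; induct b rule: idx; induct c rule: idx;
        simp only: B simps tn2_bracket_basis tn2_parity.simps vec.scale_scale
          vec.scale_zero_right add_0_left add_0_right;
        ((rule comb comb0 eq; simp add: field_simps; fail) | simp; fail)?)
qed

theorem lie_superalgebra_tn2: "lie_superalgebra tn2_parity tn2_bracket"
  unfolding lie_superalgebra_def
proof (intro conjI allI ballI)
  note br = br_simps[OF bilinear_tn2_bracket]
  show "bilinear_map tn2_bracket"
    by (rule bilinear_tn2_bracket)
  fix i j x y
  assume x: "x \<in> homog tn2_parity i" and y: "y \<in> homog tn2_parity j"
  show "tn2_bracket x y \<in> homog tn2_parity (i + j)"
    using x
  proof (induction rule: homog_induct)
    case (scale c a)
    from y have "tn2_bracket (basis a) y \<in> homog tn2_parity (i + j)"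
    proof (induction rule: homog_induct)
      case (scale d b)
      then show ?case
        using tn2_basis_bracket_homog[of a b] \<open>tn2_parity a = i\<close> by (simp add: br homog_subspace)
    qed (simp_all add: br homog_subspace)
    then show ?case by (simp add: br homog_subspace)
  qed (simp_all add: br homog_subspace)
  show "tn2_bracket x y = - scale (zsign (i * j)) (tn2_bracket y x)"
    using x
  proof (induction rule: homog_induct)
    case (scale c a)
    from y have "tn2_bracket (basis a) y = - scale (zsign (i * j)) (tn2_bracket y (basis a))"
    proof (induction rule: homog_induct)
      case (scale d b)
      then show ?case
        using tn2_basis_bracket_skew[of a b] \<open>tn2_parity a = i\<close> by (simp add: br mult.commute)
    qed (simp_all add: br vec.scale_right_distrib)
    then show ?case by (simp add: br mult.commute)
  qed (simp_all add: br vec.scale_right_distrib)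
  fix k z
  assume z: "z \<in> homog tn2_parity k"
  show "tn2_bracket x (tn2_bracket y z) = tn2_bracket (tn2_bracket x y) z
      + scale (zsign (i * j)) (tn2_bracket y (tn2_bracket x z))"
    using x
  proof (induction rule: homog_induct)
    case (scale c a)
    from y have "tn2_bracket (basis a) (tn2_bracket y z) = tn2_bracket (tn2_bracket (basis a) y) z
      + scale (zsign (i * j)) (tn2_bracket y (tn2_bracket (basis a) z))"
    proof (induction rule: homog_induct)
      case (scale d b)
      have "tn2_bracket (basis a) (tn2_bracket (basis b) z)
          = tn2_bracket (tn2_bracket (basis a) (basis b)) z
          + scale (zsign (i * j)) (tn2_bracket (basis b) (tn2_bracket (basis a) z))"
      proof (induction z rule: vec_induct)
        case (scale e c)
        then show ?case
          using tn2_jacobi_basis[of a b c] \<open>tn2_parity a = i\<close> \<open>tn2_parity b = j\<close>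
          by (simp add: br vec.scale_right_distrib mult.commute)
      qed (simp_all add: br vec.scale_right_distrib)
      then show ?case by (simp add: br vec.scale_right_distrib mult.commute)
    qed (simp_all add: br vec.scale_right_distrib)
    then show ?case by (simp add: br vec.scale_right_distrib mult.commute)
  qed (simp_all add: br vec.scale_right_distrib)
qed

end

theory Submission
  imports Defs
begin

text \<open>
  Write \<open>\<L>\<close> for the algebra. The proof rests on two facts: \<open>\<L> \<otimes> M\<close> has no invariants for any
  \<open>M\<close> (\<open>no_invariants\<close>), and every even derivation \<open>\<L> \<rightarrow> \<L> \<otimes> \<L>\<close> is inner
  (\<open>first_cohomology_vanishes\<close>).

  The first fact holds because \<open>L\<^sub>m\<close> with \<open>m\<close> large moves a given tensor, in its first factor, outside
  of its support, and nothing can cancel there. The compatibility of \<open>\<Delta>\<close> with the bracket says that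
  \<open>\<Delta>\<close> is an even derivation, so the second fact gives an even \<open>r\<close> with \<open>\<Delta> x = x * r\<close>. As the
  values of \<open>\<Delta>\<close> are skew, \<open>r + \<tau> r\<close> is invariant, hence \<open>0\<close>, and \<open>r\<close> is skew. For a skew
  even \<open>r\<close> the left hand side of the co-Jacobi identity at \<open>x\<close> is \<open>x * c(r)\<close>
  (\<open>co_jacobi_cybe\<close>), so \<open>c(r)\<close> is invariant and hence \<open>0\<close>.

  The derivations are treated in three steps; each subtracts an inner derivation. As \<open>L\<^sub>0\<close> acts
  diagonally, one can reach a derivation \<open>D\<close> that preserves the \<open>L\<^sub>0\<close>-weight and kills \<open>L\<^sub>0\<close>
  (\<open>even_derivation_weight_reduction\<close>). Now \<open>G\<^sub>0\<close> squares to \<open>L\<^sub>0\<close>, so it is a differential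
  on the tensors of weight \<open>0\<close>; the tensor \<open>D(G\<^sub>0)\<close> is a cycle for it, and in this degree every
  cycle is a boundary (\<open>act_G0_cocycle\<close>). So one can assume \<open>D(G\<^sub>0) = 0\<close>, and one may still
  subtract the inner derivations of tensors of weight \<open>0\<close> that \<open>G\<^sub>0\<close> kills. They suffice to
  remove two families of coordinates of \<open>D(T\<^bsub>1/2\<^esub>)\<close> (\<open>normalize_T0\<close>). The relations
  \<open>[T\<^bsub>1/2\<^esub>, T\<^bsub>-1/2\<^esub>] = 0\<close> and \<open>[T\<^bsub>1/2\<^esub>, [T\<^bsub>-1/2\<^esub>, G\<^sub>0]] = G\<^sub>0\<close> make the other coordinates of
  \<open>D(T\<^bsub>1/2\<^esub>)\<close> and \<open>D(T\<^bsub>-1/2\<^esub>)\<close> vanish or be constant along infinite strings of indices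
  (\<open>normalized_derivation_eq_0\<close>), and supports are finite. As \<open>T\<^bsub>1/2\<^esub>\<close>, \<open>T\<^bsub>-1/2\<^esub>\<close> and \<open>G\<^sub>0\<close>
  generate \<open>\<L>\<close>, it follows that \<open>D = 0\<close>.
\<close>


section \<open>Linear extension and signs\<close>

lemma zsign_simps [simp]: "zsign 0 = 1" "zsign 1 = -1"
  by (simp_all add: zsign_def)

lemma lin_fun_minus [simp]: "lin (\<lambda>b. - f b) x = - lin f x"
  by (simp add: lin_def sum_negf)

lemma lin_minus [simp]: "lin f (- x) = - lin f x"
  using lin_scale[of f "-1" x] by simp

lemma lin_diff [simp]: "lin f (x - y) = lin f x - lin f y"
  using lin_add[of f x "- y"] by simp

lemma lin_fun_diff [simp]: "lin (\<lambda>b. f b - g b) x = lin f x - lin g x"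
  using lin_fun_add[of f "\<lambda>b. - g b" x] by simp

lemma lin_lin: "lin g (lin f x) = lin (\<lambda>b. lin g (f b)) x"
  by (induction x rule: vec_induct) simp_all

lemma lin_swap: "lin (\<lambda>a. lin (f a) y) x = lin (\<lambda>b. lin (\<lambda>a. f a b) x) y"
  by (induction x rule: vec_induct) simp_all

lemma lin_cong_homog:
  assumes "x \<in> homog par i" "\<And>b. par b = i \<Longrightarrow> f b = g b"
  shows "lin f x = lin g x"
  using assms by (auto simp: lin_def homog_def intro!: sum.cong)

lemma tens_minus [simp]: "(- x) \<otimes> z = - (x \<otimes> z)" "z \<otimes> (- x) = - (z \<otimes> x)"
  using tens_simps(3)[of "-1" x z] tens_simps(4)[of z "-1" x] by simp_all

lemma tens_diff [simp]: "(x - y) \<otimes> z = x \<otimes> z - y \<otimes> z" "z \<otimes> (x - y) = z \<otimes> x - z \<otimes> y"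
  using tens_simps(1)[of x "- y" z] tens_simps(2)[of z x "- y"] by simp_all

lemma bilinear_map_simps:
  assumes "bilinear_map f"
  shows "f (x + y) z = f x z + f y z" "f w (u + v) = f w u + f w v"
    "f (scale c x) z = scale c (f x z)" "f w (scale c u) = scale c (f w u)"
    "f 0 z = 0" "f w 0 = 0"
proof -
  show *: "f (x + y) z = f x z + f y z" "f w (u + v) = f w u + f w v"
    "f (scale c x) z = scale c (f x z)" "f w (scale c u) = scale c (f w u)" for x y z w u v c
    using assms by (auto simp: bilinear_map_def linear_map_iff)
  show "f 0 z = 0" "f w 0 = 0"
    using *(3)[of 0 0 z] *(4)[of w 0 0] by simp_all
qed

lemma tens_lin: "z \<otimes> lin f x = lin (\<lambda>b. z \<otimes> f b) x"
  by (induction x rule: vec_induct) simp_all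

lemma super_twist_lin: "lin f (super_twist par s) =
    lin (\<lambda>(a, b). scale (zsign (par a * par b)) (f (b, a))) s"
  by (induction s rule: vec_induct) (auto simp: super_twist_def split: prod.splits)

lemma super_twist_linear:
  "super_twist par (s + t) = super_twist par s + super_twist par t"
  "super_twist par (scale k s) = scale k (super_twist par s)"
  "super_twist par (- s) = - super_twist par s"
  "super_twist par (s - t) = super_twist par s - super_twist par t"
  "super_twist par 0 = 0"
  by (simp_all add: super_twist_def)

lemma super_twist_super_twist [simp]: "super_twist par (super_twist par t) = t"
proof (induction t rule: vec_induct)
  case (scale c b)
  then show ?case
    by (cases b; cases "par (fst b)"; cases "par (snd b)") (simp_all add: super_twist_def)
qed (simp_all add: super_twist_def)

lemma skew_tensors_iff: "t \<in> skew_tensors par \<longleftrightarrow> super_twist par t = - t"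
proof
  assume "t \<in> skew_tensors par"
  then obtain u where "t = u - super_twist par u"
    by (auto simp: skew_tensors_def)
  moreover have "super_twist par (u - super_twist par u) = super_twist par u - super_twist par (super_twist par u)"
    by (simp add: super_twist_def)
  ultimately show "super_twist par t = - t"
    by simp
next
  assume "super_twist par t = - t"
  \<comment> \<open>The factor \<open>1/2\<close>: on a skew tensor, \<open>1 - \<tau>\<close> is multiplication by \<open>2\<close>.\<close>
  then have "super_twist par (scale (1/2) t) = - scale (1/2) t"
    by (simp add: super_twist_def)
  moreover have "t = scale (1/2) t + scale (1/2) t"
    by (simp flip: vec.scale_left_distrib)
  ultimately have "t = scale (1/2) t - super_twist par (scale (1/2) t)"
    by simp
  then show "t \<in> skew_tensors par"
    unfolding skew_tensors_def by blast
qed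

text \<open>In a sum over a skew tensor the two factors can be exchanged at the cost of a sign.\<close>

lemma lin_skew:
  assumes "super_twist par s = - s"
  shows "lin f s = - lin (\<lambda>(a, b). scale (zsign (par a * par b)) (f (b, a))) s"
proof -
  have "lin f (super_twist par s) = - lin f s"
    by (simp add: assms)
  then show ?thesis
    unfolding super_twist_lin by (metis minus_minus)
qed

lemma super_cyclic_thrice [simp]:
  "super_cyclic par (super_cyclic par (super_cyclic par t)) = t"
proof (induction t rule: vec_induct)
  case (scale c b)
  obtain x y z where "b = (x, y, z)" by (cases b)
  then show ?case
    by (cases "par x"; cases "par y"; cases "par z") (simp_all add: super_cyclic_def)
qed (simp_all add: super_cyclic_def)


section \<open>The co-Jacobi identity and the classical Yang--Baxter expression\<close>

text \<open>
  The diagonal action on \<open>V \<otimes> M\<close> for a module \<open>M\<close> with action \<open>\<rho>\<close>. It covers the adjoint action on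
  \<open>V \<otimes> V\<close> as well as the one on \<open>V \<otimes> (V \<otimes> V)\<close>.
\<close>

definition diag_act :: "('b \<Rightarrow> bit) \<Rightarrow> ('b vec \<Rightarrow> 'b vec \<Rightarrow> 'b vec) \<Rightarrow>
    ('b vec \<Rightarrow> 'm vec \<Rightarrow> 'm vec) \<Rightarrow> 'b vec \<Rightarrow> ('b \<times> 'm) vec \<Rightarrow> ('b \<times> 'm) vec" where
  "diag_act par br \<rho> x t = lin (\<lambda>c. lin (\<lambda>(a, z).
     br (basis c) (basis a) \<otimes> basis z
     + scale (zsign (par c * par a)) (basis a \<otimes> \<rho> (basis c) (basis z))) t) x"

lemma adj_act_diag_act: "adj_act par br = diag_act par br br"
  by (simp add: adj_act_def diag_act_def fun_eq_iff)

text \<open>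
  The three parts of \<open>c(r)\<close> as bilinear expressions in two tensors \<open>s\<close> and \<open>t\<close>. The polarization is
  needed because the co-Jacobi identity involves them for \<open>r\<close> and \<open>x * r\<close>.
\<close>

definition yb12_23 where
  "yb12_23 br s t = lin (\<lambda>(a, b). lin (\<lambda>(a', b').
     basis a \<otimes> br (basis b) (basis a') \<otimes> basis b') t) s"

definition yb13_23 where
  "yb13_23 par br s t = lin (\<lambda>(a, b). lin (\<lambda>(a', b').
     scale (zsign (par a' * par b)) (basis a \<otimes> basis a' \<otimes> br (basis b) (basis b'))) t) s"

definition yb12_13 where
  "yb12_13 par br s t = lin (\<lambda>(a, b). lin (\<lambda>(a', b').
     scale (zsign (par a' * par b)) (br (basis a) (basis a') \<otimes> basis b \<otimes> basis b')) t) s"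

lemma yb12_23_linear:
  "yb12_23 br (s + s') t = yb12_23 br s t + yb12_23 br s' t"
  "yb12_23 br s (t + t') = yb12_23 br s t + yb12_23 br s t'"
  "yb12_23 br (scale k s) t = scale k (yb12_23 br s t)"
  "yb12_23 br s (scale k t) = scale k (yb12_23 br s t)"
  "yb12_23 br 0 t = 0" "yb12_23 br s 0 = 0"
  "yb12_23 br (s - s') t = yb12_23 br s t - yb12_23 br s' t"
  "yb12_23 br s (t - t') = yb12_23 br s t - yb12_23 br s t'"
  by (simp_all add: yb12_23_def case_prod_unfold)

lemma super_cyclic_linear:
  "super_cyclic par (s + t) = super_cyclic par s + super_cyclic par t"
  "super_cyclic par (scale k s) = scale k (super_cyclic par s)"
  "super_cyclic par (- s) = - super_cyclic par s"
  "super_cyclic par (s - t) = super_cyclic par s - super_cyclic par t"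
  "super_cyclic par 0 = 0"
  by (simp_all add: super_cyclic_def)

lemma cybe_yb: "cybe par br r = yb12_13 par br r r + yb12_23 br r r + yb13_23 par br r r"
  by (simp add: cybe_def br_r12_r13_def br_r12_r23_def br_r13_r23_def
      yb12_13_def yb12_23_def yb13_23_def)

context
  fixes par :: "'b \<Rightarrow> bit" and br :: "'b vec \<Rightarrow> 'b vec \<Rightarrow> 'b vec"
  assumes lie: "lie_superalgebra par br"
begin

lemma bilinear_br: "bilinear_map br"
  using lie by (simp add: lie_superalgebra_def)

lemmas br_linear = br_simps[OF bilinear_br]

lemma br_homog: "x \<in> homog par i \<Longrightarrow> y \<in> homog par j \<Longrightarrow> br x y \<in> homog par (i + j)"
proof -
  have "\<forall>i j. \<forall>x\<in>homog par i. \<forall>y\<in>homog par j. br x y \<in> homog par (i + j)"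
    using lie unfolding lie_superalgebra_def by (elim conjE)
  then show "x \<in> homog par i \<Longrightarrow> y \<in> homog par j \<Longrightarrow> br x y \<in> homog par (i + j)"
    by blast
qed

lemma br_basis_homog: "br (basis a) (basis b) \<in> homog par (par a + par b)"
  by (intro br_homog basis_homog)

lemma br_skew: "br (basis a) (basis b) = - scale (zsign (par a * par b)) (br (basis b) (basis a))"
proof -
  have "\<forall>i j. \<forall>x\<in>homog par i. \<forall>y\<in>homog par j. br x y = - scale (zsign (i * j)) (br y x)"
    using lie unfolding lie_superalgebra_def by (elim conjE)
  from this[rule_format, OF basis_homog basis_homog] show ?thesis .
qed

lemma br_jacobi: "br (basis a) (br (basis b) (basis c)) = br (br (basis a) (basis b)) (basis c)
    + scale (zsign (par a * par b)) (br (basis b) (br (basis a) (basis c)))"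
proof -
  have "\<forall>i j k. \<forall>x\<in>homog par i. \<forall>y\<in>homog par j. \<forall>z\<in>homog par k.
      br x (br y z) = br (br x y) z + scale (zsign (i * j)) (br y (br x z))"
    using lie unfolding lie_superalgebra_def by (elim conjE)
  from this[rule_format, OF basis_homog basis_homog basis_homog] show ?thesis .
qed

lemma diag_act_tens:
  assumes \<rho>: "bilinear_map \<rho>"
    and a: "a \<in> homog par j"
  shows "diag_act par br \<rho> (basis c) (a \<otimes> z) =
    br (basis c) a \<otimes> z + scale (zsign (par c * j)) (a \<otimes> \<rho> (basis c) z)"
  using a
proof (induction rule: homog_induct)
  case (scale d f)
  have "diag_act par br \<rho> (basis c) (basis f \<otimes> z)
      = br (basis c) (basis f) \<otimes> z + scale (zsign (par c * j)) (basis f \<otimes> \<rho> (basis c) z)"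
    by (induction z rule: vec_induct)
      (simp_all add: diag_act_def bilinear_map_simps[OF \<rho>] scale vec.scale_right_distrib mult.commute)
  then show ?case
    by (simp add: diag_act_def br_linear vec.scale_right_distrib mult.commute)
qed (simp_all add: diag_act_def br_linear vec.scale_right_distrib)

lemma bilinear_adj_act: "bilinear_map (adj_act par br)"
  by (simp add: bilinear_map_def linear_map_iff adj_act_simps[OF bilinear_br])

lemmas adj_act_linear = adj_act_simps[OF bilinear_br]

lemma adj_act_linear':
  "adj_act par br x (- s) = - adj_act par br x s"
  "adj_act par br x (s - t) = adj_act par br x s - adj_act par br x t"
  by (simp_all add: adj_act_def)

lemma triple_act_linear:
  "diag_act par br \<rho> x (s + t) = diag_act par br \<rho> x s + diag_act par br \<rho> x t"
  "diag_act par br \<rho> x (scale k s) = scale k (diag_act par br \<rho> x s)"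
  "diag_act par br \<rho> x (- s) = - diag_act par br \<rho> x s"
  "diag_act par br \<rho> x 0 = 0"
  by (simp_all add: diag_act_def)

lemma yb12_23_tens:
  "yb12_23 br (s \<otimes> s') (t \<otimes> t') = s \<otimes> br s' t \<otimes> t'"
proof -
  have bb: "yb12_23 br (basis a \<otimes> basis b) (basis c \<otimes> basis d) = basis a \<otimes> br (basis b) (basis c) \<otimes> basis d"
    for a b c d
    by (simp add: yb12_23_def)
  have c: "yb12_23 br (basis a \<otimes> basis b) (basis c \<otimes> t') = basis a \<otimes> br (basis b) (basis c) \<otimes> t'"
    for a b c
    by (induction t' rule: vec_induct) (simp_all add: yb12_23_linear bb del: tens_simps(7))
  have b: "yb12_23 br (basis a \<otimes> basis b) (t \<otimes> t') = basis a \<otimes> br (basis b) t \<otimes> t'" for a b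
    by (induction t rule: vec_induct) (simp_all add: yb12_23_linear br_linear c del: tens_simps(7))
  have a: "yb12_23 br (basis a \<otimes> s') (t \<otimes> t') = basis a \<otimes> br s' t \<otimes> t'" for a
    by (induction s' rule: vec_induct) (simp_all add: yb12_23_linear br_linear b del: tens_simps(7))
  show ?thesis
    by (induction s rule: vec_induct) (simp_all add: yb12_23_linear br_linear a del: tens_simps(7))
qed

lemma adj_act_basis:
  assumes "a \<in> homog par j"
  shows "adj_act par br (basis c) (a \<otimes> b) =
    br (basis c) a \<otimes> b + scale (zsign (par c * j)) (a \<otimes> br (basis c) b)"
  using adj_act_tens[OF bilinear_br basis_homog assms] .

text \<open>The tensor square is a module.\<close>

lemma adj_act_bracket:
  "adj_act par br (br (basis c) (basis d)) t = adj_act par br (basis c) (adj_act par br (basis d) t)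
    - scale (zsign (par c * par d)) (adj_act par br (basis d) (adj_act par br (basis c) t))"
proof (induction t rule: vec_induct)
  case (scale k e)
  obtain a b where e: "e = (a, b)" by (cases e)
  have "adj_act par br (br (basis c) (basis d)) (basis a \<otimes> basis b) =
      adj_act par br (basis c) (adj_act par br (basis d) (basis a \<otimes> basis b))
      - scale (zsign (par c * par d)) (adj_act par br (basis d) (adj_act par br (basis c) (basis a \<otimes> basis b)))"
    by (cases "par a"; cases "par c"; cases "par d")
      (simp_all add: adj_act_tens[OF bilinear_br br_basis_homog basis_homog] adj_act_basis[OF basis_homog]
        adj_act_basis[OF br_basis_homog] adj_act_linear adj_act_linear' br_linear br_jacobi[of c d a] br_jacobi[of c d b]
        del: tens_simps(7))
  then show ?case
    by (simp add: e adj_act_linear vec.scale_right_diff_distrib mult.commute)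
next
  case (add t u)
  then show ?case
    by (simp only: adj_act_linear vec.scale_right_distrib add_diff_add)
qed (simp add: adj_act_linear)

text \<open>The twist is a map of modules, so \<open>\<tau> r\<close> induces the twisted inner derivation.\<close>

lemma super_twist_adj_act:
  "super_twist par (adj_act par br (basis c) t) = adj_act par br (basis c) (super_twist par t)"
proof (induction t rule: vec_induct)
  case (scale k e)
  obtain a b where e: "e = (a, b)" by (cases e)
  have "super_twist par (adj_act par br (basis c) (basis a \<otimes> basis b)) =
      adj_act par br (basis c) (super_twist par (basis a \<otimes> basis b))"
    by (cases "par a"; cases "par b"; cases "par c")
      (simp_all add: adj_act_basis[OF basis_homog] super_twist_linear adj_act_linear adj_act_linear'
        super_twist_tens[OF basis_homog basis_homog] super_twist_tens[OF br_basis_homog basis_homog]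
        super_twist_tens[OF basis_homog br_basis_homog] del: tens_simps(7))
  then show ?case
    by (simp add: e adj_act_linear super_twist_linear)
qed (simp_all add: adj_act_linear super_twist_linear)

lemma adj_act_homog:
  assumes "t \<in> homog (tensor_parity par par) i"
  shows "adj_act par br (basis c) t \<in> homog (tensor_parity par par) (par c + i)"
  using assms
proof (induction rule: homog_induct)
  case (scale k e)
  obtain a b where e: "e = (a, b)" by (cases e)
  have "br (basis c) (basis a) \<otimes> basis b \<in> homog (tensor_parity par par) (par c + par a + par b)"
    "basis a \<otimes> br (basis c) (basis b) \<in> homog (tensor_parity par par) (par a + (par c + par b))"
    by (intro tens_homog br_basis_homog basis_homog)+
  moreover have "par c + i = par c + par a + par b" "par c + i = par a + (par c + par b)"
    unfolding scale[symmetric] e tensor_parity_def prod.case by (simp_all only: ac_simps)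
  ultimately have "adj_act par br (basis c) (basis a \<otimes> basis b) \<in> homog (tensor_parity par par) (par c + i)"
    unfolding adj_act_basis[OF basis_homog] by (metis homog_subspace(2,3))
  then show ?case
    by (simp add: e adj_act_linear homog_subspace)
qed (simp_all add: adj_act_linear homog_subspace)

lemma triple_act_basis:
  assumes "a \<in> homog par i" "b \<in> homog par j"
  shows "diag_act par br (adj_act par br) (basis x) (a \<otimes> b \<otimes> c) =
    br (basis x) a \<otimes> b \<otimes> c + scale (zsign (par x * i)) (a \<otimes> br (basis x) b \<otimes> c)
    + scale (zsign (par x * i) * zsign (par x * j)) (a \<otimes> b \<otimes> br (basis x) c)"
  by (simp add: diag_act_tens[OF bilinear_adj_act assms(1)] adj_act_basis[OF assms(2)]
      vec.scale_right_distrib)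

text \<open>
  The cyclic permutation is a map of modules, so the cyclic sum of \<open>x * t\<close> is \<open>x\<close> applied to the cyclic sum of \<open>t\<close>.
\<close>

lemma super_cyclic_triple_act:
  "super_cyclic par (diag_act par br (adj_act par br) (basis x) t) =
    diag_act par br (adj_act par br) (basis x) (super_cyclic par t)"
proof (induction t rule: vec_induct)
  case (scale k e)
  obtain a b c where e: "e = (a, b, c)" by (cases e)
  have "super_cyclic par (diag_act par br (adj_act par br) (basis x) (basis a \<otimes> basis b \<otimes> basis c)) =
      diag_act par br (adj_act par br) (basis x) (super_cyclic par (basis a \<otimes> basis b \<otimes> basis c))"
    by (cases "par a"; cases "par b"; cases "par c"; cases "par x")
      (simp_all add: triple_act_basis[OF basis_homog basis_homog] super_cyclic_linear triple_act_linear
      super_cyclic_tens[OF basis_homog basis_homog basis_homog]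
      super_cyclic_tens[OF br_basis_homog basis_homog basis_homog]
      super_cyclic_tens[OF basis_homog br_basis_homog basis_homog]
      super_cyclic_tens[OF basis_homog basis_homog br_basis_homog]
      del: tens_simps(7))
  then show ?case unfolding e
    by (simp add: super_cyclic_linear triple_act_linear)
qed (simp_all add: super_cyclic_linear triple_act_linear)

text \<open>
  The bracket of the two inner factors is a map of modules by the Jacobi identity. No sign appears in
  front of the last term because \<open>s\<close> is even.
\<close>

lemma yb12_23_equivariant:
  assumes s: "s \<in> homog (tensor_parity par par) 0"
  shows "diag_act par br (adj_act par br) (basis x) (yb12_23 br s t) =
    yb12_23 br (adj_act par br (basis x) s) t + yb12_23 br s (adj_act par br (basis x) t)"
  using s
proof (induction rule: homog_induct)
  case (scale k e)
  obtain a b where e: "e = (a, b)" by (cases e)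
  have ab: "par a = par b"
    using scale unfolding e by (cases "par a"; cases "par b") (simp_all add: tensor_parity_def)
  have "diag_act par br (adj_act par br) (basis x) (yb12_23 br (basis a \<otimes> basis b) t) =
    yb12_23 br (adj_act par br (basis x) (basis a \<otimes> basis b)) t
      + yb12_23 br (basis a \<otimes> basis b) (adj_act par br (basis x) t)"
  proof (induction t rule: vec_induct)
    case (scale k' e')
    obtain c d where e': "e' = (c, d)" by (cases e')
    have "diag_act par br (adj_act par br) (basis x) (yb12_23 br (basis a \<otimes> basis b) (basis c \<otimes> basis d)) =
      yb12_23 br (adj_act par br (basis x) (basis a \<otimes> basis b)) (basis c \<otimes> basis d)
        + yb12_23 br (basis a \<otimes> basis b) (adj_act par br (basis x) (basis c \<otimes> basis d))"
      using ab
      by (cases "par b"; cases "par c"; cases "par x")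
       (simp_all add: triple_act_basis[OF basis_homog br_basis_homog] yb12_23_tens
         yb12_23_linear adj_act_basis[OF basis_homog] br_jacobi[of x b c] algebra_simps
         del: tens_simps(7))
    then show ?case
      by (simp add: e' yb12_23_linear triple_act_linear adj_act_linear vec.scale_right_distrib)
  qed (simp_all add: yb12_23_linear triple_act_linear adj_act_linear vec.scale_right_distrib)
  then show ?case
    by (simp add: e yb12_23_linear triple_act_linear adj_act_linear vec.scale_right_distrib)
qed (simp_all add: yb12_23_linear triple_act_linear adj_act_linear vec.scale_right_distrib)

text \<open>
  The cyclic permutation carries \<open>a \<otimes> c \<otimes> [b, d]\<close> to a multiple of \<open>c \<otimes> [b, d] \<otimes> a\<close>. Skewness of \<open>s\<close>
  exchanges \<open>a\<close> and \<open>b\<close>, and skewness of the bracket turns this into \<open>c \<otimes> [d, a] \<otimes> b\<close>. The signs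
  cancel as \<open>t\<close> is even. In the application \<open>s\<close> is \<open>x * r\<close>, which has the parity of \<open>x\<close>.
\<close>

lemma super_cyclic_yb13_23:
  assumes s: "super_twist par s = - s" and t: "t \<in> homog (tensor_parity par par) 0"
  shows "super_cyclic par (yb13_23 par br s t) = yb12_23 br t s"
proof -
  have "super_cyclic par (yb13_23 par br s t) = lin (\<lambda>(c, d). lin (\<lambda>(a, b).
      super_cyclic par (scale (zsign (par c * par b)) (basis a \<otimes> basis c \<otimes> br (basis b) (basis d)))) s) t"
    unfolding yb13_23_def super_cyclic_def lin_lin case_prod_unfold by (rule lin_swap)
  also have "\<dots> = lin (\<lambda>(c, d). lin (\<lambda>(a, b).
      basis c \<otimes> br (basis d) (basis a) \<otimes> basis b) s) t"
  proof (rule lin_cong_homog[OF t], clarify)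
    fix c d assume "tensor_parity par par (c, d) = 0"
    then have cd: "par c = par d"
      by (cases "par c"; cases "par d") (simp_all add: tensor_parity_def)
    have pw: "- scale (zsign (par a * par b)) (super_cyclic par
        (scale (zsign (par c * par a)) (basis b \<otimes> basis c \<otimes> br (basis a) (basis d)))) =
        basis c \<otimes> br (basis d) (basis a) \<otimes> basis b" for a b
      using cd by (subst br_skew[of d a], cases "par a"; cases "par b"; cases "par d")
        (simp_all add: super_cyclic_linear super_cyclic_tens[OF basis_homog basis_homog br_basis_homog]
          del: tens_simps(7))
    let ?A = "\<lambda>(a, b). super_cyclic par
        (scale (zsign (par c * par b)) (basis a \<otimes> basis c \<otimes> br (basis b) (basis d)))"
    have "lin ?A s = - lin (\<lambda>(a, b). scale (zsign (par a * par b)) (?A (b, a))) s"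
      by (rule lin_skew[OF s])
    also have "\<dots> = lin (\<lambda>p. - (case p of (a, b) \<Rightarrow> scale (zsign (par a * par b)) (?A (b, a)))) s"
      by (simp only: lin_fun_minus)
    also have "\<dots> = lin (\<lambda>(a, b). basis c \<otimes> br (basis d) (basis a) \<otimes> basis b) s"
      by (simp only: case_prod_unfold fst_conv snd_conv pw)
    finally show "lin ?A s = lin (\<lambda>(a, b). basis c \<otimes> br (basis d) (basis a) \<otimes> basis b) s" .
  qed
  also have "\<dots> = yb12_23 br t s"
    by (simp add: yb12_23_def)
  finally show ?thesis .
qed

text \<open>
  Here \<open>[a, c] \<otimes> b \<otimes> d\<close> goes to a multiple of \<open>b \<otimes> d \<otimes> [a, c]\<close>, and both \<open>s\<close> and \<open>t\<close> have to be
  flipped to reach \<open>a \<otimes> c \<otimes> [b, d]\<close>.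
\<close>

lemma super_cyclic_yb12_13:
  assumes s: "super_twist par s = - s" "s \<in> homog (tensor_parity par par) 0"
    and t: "super_twist par t = - t" "t \<in> homog (tensor_parity par par) 0"
  shows "super_cyclic par (yb12_13 par br s t) = yb13_23 par br s t"
proof -
  define A where "A = (\<lambda>(a, b) (c, d). super_cyclic par
    (scale (zsign (par c * par b)) (br (basis a) (basis c) \<otimes> basis b \<otimes> basis d)))"
  have pw: "scale (zsign (par a * par b)) (scale (zsign (par c * par d)) (A (b, a) (d, c)))
      = scale (zsign (par c * par b)) (basis a \<otimes> basis c \<otimes> br (basis b) (basis d))"
    if "par a = par b" "par c = par d" for a b c d
    using that by (cases "par b"; cases "par d")
      (simp_all add: A_def super_cyclic_linear super_cyclic_tens[OF br_basis_homog basis_homog basis_homog]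
          del: tens_simps(7))
  have inner: "lin (A p) t = - lin (\<lambda>(c, d). scale (zsign (par c * par d)) (A p (d, c))) t" for p
    by (rule lin_skew[OF t(1)])
  have outer: "lin (\<lambda>p. lin (\<lambda>(c, d). scale (zsign (par c * par d)) (A p (d, c))) t) s =
      - lin (\<lambda>(a, b). scale (zsign (par a * par b))
        (lin (\<lambda>(c, d). scale (zsign (par c * par d)) (A (b, a) (d, c))) t)) s"
    by (rule lin_skew[OF s(1)])
  have even: "par (fst p) = par (snd p)" if "tensor_parity par par p = 0" for p
    using that by (cases p; cases "par (fst p)"; cases "par (snd p)") (simp_all add: tensor_parity_def)
  have "super_cyclic par (yb12_13 par br s t) = lin (\<lambda>p. lin (A p) t) s"
    unfolding yb12_13_def super_cyclic_def lin_lin case_prod_unfold A_def ..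
  also have "\<dots> = - lin (\<lambda>p. lin (\<lambda>(c, d). scale (zsign (par c * par d)) (A p (d, c))) t) s"
    unfolding inner lin_fun_minus ..
  also have "\<dots> = lin (\<lambda>(a, b). scale (zsign (par a * par b))
      (lin (\<lambda>(c, d). scale (zsign (par c * par d)) (A (b, a) (d, c))) t)) s"
    unfolding outer minus_minus ..
  also have "\<dots> = yb13_23 par br s t"
    unfolding yb13_23_def lin_fun_scale[symmetric] case_prod_unfold fst_conv snd_conv
    by (intro lin_cong_homog[OF s(2)] lin_cong_homog[OF t(2)] pw even)
  finally show ?thesis .
qed

text \<open>By the two previous lemmas the parts of \<open>c(r)\<close> are cyclic permutations of one another.\<close>

lemma cybe_cyclic_sum:
  assumes r: "super_twist par r = - r" "r \<in> homog (tensor_parity par par) 0"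
  shows "cybe par br r = yb12_23 br r r + super_cyclic par (yb12_23 br r r)
    + super_cyclic par (super_cyclic par (yb12_23 br r r))"
proof -
  have F: "yb12_23 br r r = super_cyclic par (yb13_23 par br r r)"
    using super_cyclic_yb13_23[OF r] by simp
  have H: "yb13_23 par br r r = super_cyclic par (yb12_13 par br r r)"
    using super_cyclic_yb12_13[OF r r] by simp
  show ?thesis
    unfolding cybe_yb F by (simp add: H algebra_simps)
qed

lemma tensor_map_adj_act:
  "tensor_map id (\<lambda>x. adj_act par br x r) s = yb12_23 br s r + yb13_23 par br s r"
proof -
  have eq: "basis a \<otimes> adj_act par br (basis b) r =
      lin (\<lambda>(c, d). basis a \<otimes> br (basis b) (basis c) \<otimes> basis d) r +
      lin (\<lambda>(c, d). scale (zsign (par c * par b)) (basis a \<otimes> basis c \<otimes> br (basis b) (basis d))) r" for a b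
    unfolding adj_act_def lin_basis tens_lin lin_fun_add[symmetric] case_prod_unfold tens_simps
    by (simp only: mult.commute)
  have "tensor_map id (\<lambda>x. adj_act par br x r) s =
      lin (\<lambda>(a, b). basis a \<otimes> adj_act par br (basis b) r) s"
    by (simp only: tensor_map_def id_apply)
  then show ?thesis
    unfolding eq by (simp add: yb12_23_def yb13_23_def case_prod_unfold)
qed

text \<open>
  Let \<open>E(s, t)\<close> and \<open>F(s, t)\<close> be \<open>yb12_23\<close> and \<open>yb13_23\<close>. With \<open>\<Delta> = \<Delta>\<^sub>r\<close> the tensor
  \<open>(1 \<otimes> \<Delta>)(s)\<close> is \<open>E(s, r) + F(s, r)\<close>, and \<open>F(s, r)\<close> has the same cyclic sum as \<open>E(r, s)\<close>. For
  \<open>s = x * r\<close> the sum \<open>E(x * r, r) + E(r, x * r)\<close> is \<open>x * E(r, r)\<close>, whose cyclic sum is \<open>x * c(r)\<close>.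
\<close>

theorem co_jacobi_cybe:
  assumes r: "super_twist par r = - r" "r \<in> homog (tensor_parity par par) 0"
    and sk: "super_twist par (adj_act par br (basis x) r) = - adj_act par br (basis x) r"
    and u: "u = tensor_map id (\<lambda>x. adj_act par br x r) (adj_act par br (basis x) r)"
  shows "u + super_cyclic par u + super_cyclic par (super_cyclic par u) =
    diag_act par br (adj_act par br) (basis x) (cybe par br r)"
proof -
  define s where "s = adj_act par br (basis x) r"
  define F where "F = yb13_23 par br s r"
  define E where "E = yb12_23 br s r"
  have F: "super_cyclic par F = yb12_23 br r s"
    unfolding F_def using super_cyclic_yb13_23[OF _ r(2)] sk s_def by simp
  have "super_cyclic par (super_cyclic par (yb12_23 br r s)) = F"
    by (simp flip: F)
  moreover have "u = E + F"
    by (simp add: u tensor_map_adj_act E_def F_def s_def)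
  moreover have "diag_act par br (adj_act par br) (basis x) (yb12_23 br r r) = E + yb12_23 br r s"
    using yb12_23_equivariant[OF r(2)] by (simp add: E_def s_def)
  ultimately show ?thesis
    unfolding cybe_cyclic_sum[OF r]
    by (simp add: triple_act_linear super_cyclic_linear F flip: super_cyclic_triple_act)
qed

end


section \<open>The action in coordinates\<close>

text \<open>
  For basis elements \<open>c\<close>, the map \<open>ad c\<close> carries basis elements to multiples of basis elements, and no
  two of them to nonzero multiples of the same one. So the \<open>e\<close>-coordinate of \<open>[c, y]\<close> is a multiple
  of a single coordinate of \<open>y\<close>. The first component is the factor, the second one the index of this
  coordinate (an arbitrary index where the factor is \<open>0\<close>).
\<close>

fun ad_transposed :: "tn2_index \<Rightarrow> tn2_index \<Rightarrow> complex \<times> tn2_index" where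
  "ad_transposed (L m) (L n) = (2 * of_int m - of_int n, L (n - m))"
| "ad_transposed (L m) (T k) = (of_int m - of_int k - 1/2, T (k - m))"
| "ad_transposed (L m) (G a) = (3 * of_int m / 2 - of_int a / 2, G (a - 2 * m))"
| "ad_transposed (T k) (L n) = (0, L n)"
| "ad_transposed (T k) (T l) = (of_int k + 1/2, L (l - k))"
| "ad_transposed (T k) (G a) = (1, G (a - (2 * k + 1)))"
| "ad_transposed (G a) (L n) = ((-1) powi a * 2, G (2 * n - a))"
| "ad_transposed (G a) (T k) = ((-1) powi (a + 1) * (of_int a - of_int k - 1/2), G (2 * k + 1 - a))"
| "ad_transposed (G a) (G b) = (if even (b - a)
     then (3 * of_int a / 4 - of_int b / 4, L ((b - a) div 2)) else (-1, T ((b - a) div 2)))"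

definition ad_coef where "ad_coef c e = fst (ad_transposed c e)"
definition ad_src where "ad_src c e = snd (ad_transposed c e)"

lemmas ad_defs = ad_coef_def ad_src_def

lemma lookup_basis: "Poly_Mapping.lookup (basis a) b = (if a = b then 1 else 0)"
  by (simp add: basis_def lookup_single when_def)

text \<open>
  The value of \<open>ad G\<^sub>p\<close> on \<open>G\<^sub>q\<close> depends on the parity of the doubled indices, so these are split.
\<close>

lemma index_cases [case_names L T G_even G_odd]:
  obtains m where "e = L m" | k where "e = T k" | m where "e = G (2 * m)" | k where "e = G (2 * k + 1)"
  by (cases e) (simp, simp, metis evenE oddE)

lemma half_simps: "(2 * x + 1 + 2 * y) div 2 = x + (y::int)" "(2 * x + (2 * y + 1)) div 2 = x + y"
  "(2 * x + 1 + (2 * y + 1)) div 2 = x + y + 1" "(2 * x + 2 * y) div 2 = x + y"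
  "(2 * x + 1 - 2 * y) div 2 = x - y" "(2 * x - (2 * y + 1)) div 2 = x - y - 1"
  "(2 * x + 1 - (2 * y + 1)) div 2 = x - y" "(2 * x - 2 * y) div 2 = x - y"
  by presburger+

lemma parity_simps:
  "2 * x + 2 * y = 2 * z + 1 \<longleftrightarrow> False" "2 * x + (2 * y + 1) = 2 * z \<longleftrightarrow> False"
  "2 * x + 1 + 2 * y = 2 * z \<longleftrightarrow> False" "2 * x + 1 + (2 * y + 1) = 2 * z + 1 \<longleftrightarrow> False"
  "2 * x - 2 * y = 2 * z + 1 \<longleftrightarrow> False" "2 * x + 1 - 2 * y = 2 * z \<longleftrightarrow> False"
  "2 * x - (2 * y + 1) = 2 * z \<longleftrightarrow> False" "2 * x + 1 - (2 * y + 1) = 2 * z + 1 \<longleftrightarrow> False"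
  "1 + (2 * x + 2 * y) = 2 * z \<longleftrightarrow> False"
  "2 * x - 2 * y = 2 * z \<longleftrightarrow> x - y = (z::int)" "2 * x - (2 * y + 1) = 2 * z + 1 \<longleftrightarrow> x - y - 1 = z"
  by presburger+

lemma lookup_tn2_basis_bracket:
  "Poly_Mapping.lookup (tn2_basis_bracket c a) e = (if ad_src c e = a then ad_coef c e else 0)"
proof (cases c rule: index_cases)
  case L
  show ?thesis
    unfolding L by (cases a; cases e; auto simp: ad_defs lookup_basis diff_divide_distrib)
next
  case T
  show ?thesis
    unfolding T by (cases a; cases e; auto simp: ad_defs lookup_basis)
next
  case G_even
  show ?thesis
    unfolding G_even by (cases a rule: index_cases; cases e rule: index_cases;
      simp add: ad_defs lookup_basis lookup_minus minus_one_powi half_simps parity_simps)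
      (auto simp: add_divide_distrib diff_divide_distrib)
next
  case G_odd
  show ?thesis
    unfolding G_odd by (cases a rule: index_cases; cases e rule: index_cases;
      simp add: ad_defs lookup_basis lookup_minus minus_one_powi half_simps parity_simps)
      (auto simp: add_divide_distrib diff_divide_distrib)
qed

lemma lookup_tens: "Poly_Mapping.lookup (x \<otimes> y) (a, b) = Poly_Mapping.lookup x a * Poly_Mapping.lookup y b"
proof (induction x rule: vec_induct)
  case (scale c d)
  have "Poly_Mapping.lookup (basis d \<otimes> y) (a, b) = Poly_Mapping.lookup (basis d) a * Poly_Mapping.lookup y b"
    by (induction y rule: vec_induct) (simp_all add: lookup_add algebra_simps lookup_basis)
  then show ?case by (simp add: lookup_basis)
qed (simp_all add: lookup_add algebra_simps)

lemma lookup_adj_act: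
  "Poly_Mapping.lookup (adj_act tn2_parity tn2_bracket (basis c) t) (e, f) =
     ad_coef c e * Poly_Mapping.lookup t (ad_src c e, f)
     + zsign (tn2_parity c * tn2_parity e) * ad_coef c f * Poly_Mapping.lookup t (e, ad_src c f)"
proof (induction t rule: vec_induct)
  case (scale k d)
  obtain a b where d: "d = (a, b)" by (cases d)
  show ?case
    by (simp add: d adj_act_def lookup_add lookup_tens lookup_tn2_basis_bracket lookup_basis algebra_simps)
qed (simp_all add: adj_act_def lookup_add algebra_simps)


section \<open>Vanishing of invariants\<close>

text \<open>
  Outside of the first factors that occur in \<open>t\<close>, the action on the second factor contributes nothing.
\<close>

lemma lookup_diag_act:
  assumes "e \<notin> fst ` Poly_Mapping.keys t"
  shows "Poly_Mapping.lookup (diag_act tn2_parity tn2_bracket \<rho> (basis c) t) (e, z) =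
    ad_coef c e * Poly_Mapping.lookup t (ad_src c e, z)"
proof -
  let ?s = "lin (\<lambda>(a, z). scale (zsign (tn2_parity c * tn2_parity a)) (basis a \<otimes> \<rho> (basis c) (basis z))) t"
  let ?b = "lin (\<lambda>(a, z). tn2_basis_bracket c a \<otimes> basis z) t"
  have "Poly_Mapping.lookup ?s (e, z) = 0"
    unfolding lin_def lookup_sum
    by (rule sum.neutral) (use assms in \<open>force simp: lookup_tens lookup_basis\<close>)
  moreover have "Poly_Mapping.lookup ?b (e, z) = ad_coef c e * Poly_Mapping.lookup t (ad_src c e, z)"
  proof (induction t rule: vec_induct)
    case (scale k d)
    then show ?case
      by (cases d) (simp add: lookup_tens lookup_tn2_basis_bracket lookup_basis)
  qed (simp_all add: lookup_add algebra_simps)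
  moreover have "diag_act tn2_parity tn2_bracket \<rho> (basis c) t = ?b + ?s"
    by (simp add: diag_act_def case_prod_unfold)
  ultimately show ?thesis
    by (simp add: lookup_add)
qed

lemma odd_neq_0: "2 * of_int k + 1 \<noteq> (0::complex)"
proof -
  have "2 * k + 1 \<noteq> 0" by presburger
  then have "of_int (2 * k + 1) \<noteq> (0::complex)" by (metis of_int_eq_0_iff)
  then show ?thesis by simp
qed

text \<open>Twice the eigenvalue of \<open>- ad L\<^sub>0\<close>.\<close>

fun wt :: "tn2_index \<Rightarrow> int" where
  "wt (L m) = 2 * m"
| "wt (T k) = 2 * k + 1"
| "wt (G a) = a"

lemma finite_wt_bounded: "finite {e. \<bar>wt e\<bar> \<le> N}"
proof (rule finite_subset)
  show "{e. \<bar>wt e\<bar> \<le> N} \<subseteq> L ` {- N..N} \<union> T ` {- N - 1..N} \<union> G ` {- N..N}"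
  proof
    fix e assume "e \<in> {e. \<bar>wt e\<bar> \<le> N}"
    then show "e \<in> L ` {- N..N} \<union> T ` {- N - 1..N} \<union> G ` {- N..N}"
      by (cases e) (auto intro!: imageI)
  qed
qed simp

lemma ex_wt_bound:
  obtains N where "\<And>e z. Poly_Mapping.lookup t (e, z) \<noteq> 0 \<Longrightarrow> \<bar>wt e\<bar> \<le> N"
proof (rule that)
  let ?S = "(\<lambda>p. \<bar>wt (fst p)\<bar>) ` Poly_Mapping.keys t"
  show "\<bar>wt e\<bar> \<le> Max ?S" if "Poly_Mapping.lookup t (e, z) \<noteq> 0" for e z
    by (rule Max_ge) (use that in \<open>force simp: in_keys_iff\<close>)+
qed

text \<open>
  If \<open>e \<otimes> z\<close> occurs in \<open>t\<close> and \<open>m\<close> is large, then \<open>[L\<^sub>m, e]\<close> is a nonzero multiple of a basis element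
  \<open>e'\<close> that is not a first factor in \<open>t\<close>. So \<open>e' \<otimes> z\<close> occurs in \<open>L\<^sub>m * t\<close>.
\<close>

lemma no_invariants:
  assumes "\<And>m. diag_act tn2_parity tn2_bracket \<rho> (basis (L m)) t = 0"
  shows "t = 0"
proof (rule poly_mapping_eqI, rule ccontr)
  fix p assume "Poly_Mapping.lookup t p \<noteq> Poly_Mapping.lookup 0 p"
  then obtain e z where ez: "Poly_Mapping.lookup t (e, z) \<noteq> 0"
    by (cases p) auto
  obtain N where N: "\<And>e z. Poly_Mapping.lookup t (e, z) \<noteq> 0 \<Longrightarrow> \<bar>wt e\<bar> \<le> N"
    by (rule ex_wt_bound[of t]) blast
  \<comment> \<open>Large enough for \<open>e'\<close> to have weight above \<open>N\<close> and for the factors \<open>m - n\<close> and \<open>m/2 - p\<close> in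
    \<open>[L\<^sub>m, L\<^sub>n]\<close> and \<open>[L\<^sub>m, G\<^sub>p]\<close> to be nonzero.\<close>
  define m where "m = 2 * N + 1"
  define e' where "e' = (case e of L n \<Rightarrow> L (n + m) | T k \<Rightarrow> T (k + m) | G a \<Rightarrow> G (a + 2 * m))"
  have e: "\<bar>wt e\<bar> \<le> N"
    using N ez by blast
  have "\<bar>wt e'\<bar> > N"
    using e by (cases e) (auto simp: e'_def m_def)
  then have "e' \<notin> fst ` Poly_Mapping.keys t"
    using N by (force simp: in_keys_iff)
  moreover have "ad_src (L m) e' = e"
    by (cases e) (auto simp: e'_def ad_defs)
  moreover have "ad_coef (L m) e' \<noteq> 0"
  proof (cases e)
    case (L n)
    with e have "m \<noteq> n" by (auto simp: m_def)
    then show ?thesis by (simp add: L e'_def ad_defs)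
  next
    case (T k)
    then have coef: "ad_coef (L m) e' = (2 * of_int k + 1) * (- 1 / 2)"
      by (simp add: e'_def ad_defs field_simps)
    show ?thesis unfolding coef mult_eq_0_iff using odd_neq_0[of k] by simp
  next
    case (G a)
    with e have "m \<noteq> a" by (auto simp: m_def)
    then show ?thesis by (simp add: G e'_def ad_defs field_simps)
  qed
  ultimately show False
    using lookup_diag_act[of e' t \<rho> "L m" z] assms ez by simp
qed


section \<open>Derivations into the tensor square\<close>

abbreviation "act c \<equiv> adj_act tn2_parity tn2_bracket (basis c)"
abbreviation "tpar \<equiv> tensor_parity tn2_parity tn2_parity"

text \<open>These are the even cocycles of degree one; by linearity the conditions on the basis suffice.\<close>

definition even_derivation :: "(tn2_index vec \<Rightarrow> (tn2_index \<times> tn2_index) vec) \<Rightarrow> bool" where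
  "even_derivation D \<longleftrightarrow> linear_map D \<and> (\<forall>c. D (basis c) \<in> homog tpar (tn2_parity c)) \<and>
     (\<forall>c d. D (tn2_basis_bracket c d) =
        act c (D (basis d)) - scale (zsign (tn2_parity c * tn2_parity d)) (act d (D (basis c))))"

lemmas act_linear = adj_act_simps[OF bilinear_tn2_bracket]

lemma act_minus: "act c (- t) = - act c t" "act c (s - t) = act c s - act c t"
  by (simp_all add: adj_act_def)

lemma even_derivationD:
  assumes "even_derivation D"
  shows "D (x + y) = D x + D y" "D (scale k x) = scale k (D x)" "D 0 = 0" "D (- x) = - D x"
    "D (basis c) \<in> homog tpar (tn2_parity c)"
    "D (tn2_basis_bracket c d) =
        act c (D (basis d)) - scale (zsign (tn2_parity c * tn2_parity d)) (act d (D (basis c)))"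
proof -
  show *: "D (x + y) = D x + D y" "D (scale k x) = scale k (D x)" for x y k
    using assms by (auto simp: even_derivation_def linear_map_iff)
  show "D 0 = 0" using *(2)[of 0 0] by simp
  show "D (- x) = - D x" using *(2)[of "-1" x] by simp
qed (use assms in \<open>auto simp: even_derivation_def\<close>)

lemma inner_even_derivation:
  assumes "r \<in> homog tpar 0"
  shows "even_derivation (\<lambda>x. adj_act tn2_parity tn2_bracket x r)"
  using adj_act_bracket[OF lie_superalgebra_tn2]
    adj_act_homog[OF lie_superalgebra_tn2 assms, unfolded add_0_right]
  by (simp add: even_derivation_def linear_map_iff act_linear flip: tn2_bracket_basis)

lemma even_derivation_diff:
  assumes "even_derivation D" "even_derivation E"
  shows "even_derivation (\<lambda>x. D x - E x)"
proof -
  have "x - y \<in> homog tpar i" if "x \<in> homog tpar i" "y \<in> homog tpar i" for x y i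
    using homog_subspace(2)[OF that(1) homog_subspace(3)[OF that(2), of "-1"]] by simp
  then show ?thesis
    using assms
    by (simp add: even_derivation_def linear_map_iff vec.scale_right_diff_distrib act_minus algebra_simps)
qed

lemma even_derivation_minus_inner:
  assumes "even_derivation D" "r \<in> homog tpar 0"
  shows "even_derivation (\<lambda>x. D x - adj_act tn2_parity tn2_bracket x r)"
  by (intro even_derivation_diff inner_even_derivation assms)

text \<open>
  \<open>T\<^bsub>1/2\<^esub>\<close>, \<open>T\<^bsub>-1/2\<^esub>\<close> and \<open>G\<^sub>0\<close> generate the algebra: the first two shift \<open>G\<^sub>p\<close> to \<open>G\<^bsub>p+1/2\<^esub>\<close> and
  \<open>G\<^bsub>p-1/2\<^esub>\<close>, and the brackets \<open>[G\<^sub>p, G\<^sub>0]\<close> are nonzero multiples of all \<open>L\<^sub>p\<close> and \<open>T\<^sub>p\<close>.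
\<close>

lemma even_derivation_eq_0:
  assumes D: "even_derivation D"
    and 0: "D (basis (T 0)) = 0" "D (basis (T (- 1))) = 0" "D (basis (G 0)) = 0"
  shows "D x = 0"
proof -
  note rule = even_derivationD(6)[OF D]
  have G: "D (basis (G a)) = 0" for a
  proof (induction a rule: int_induct[where k = 0])
    case (step1 i)
    then show ?case using rule[of "T 0" "G i"] by (simp add: 0 act_linear)
  next
    case (step2 i)
    then show ?case using rule[of "T (- 1)" "G i"] by (simp add: 0 act_linear)
  qed (rule 0)
  have GG: "D (tn2_basis_bracket (G a) (G b)) = 0" for a b
    unfolding rule by (simp add: G act_linear)
  have "D (basis c) = 0" for c
  proof (cases c)
    case (L m)
    then show ?thesis using GG[of "2 * m" 0] by (simp add: even_derivationD[OF D])
  next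
    case (T k)
    then show ?thesis
      using GG[of "2 * k + 1" 0] odd_neq_0[of k]
      by (simp add: even_derivationD[OF D] minus_one_powi field_simps)
  qed (simp add: G)
  then show ?thesis
    by (induction x rule: vec_induct) (simp_all add: even_derivationD[OF D])
qed


section \<open>Weights\<close>

definition weight_tensors :: "int \<Rightarrow> (tn2_index \<times> tn2_index) vec set" where
  "weight_tensors w = {t. \<forall>e f. Poly_Mapping.lookup t (e, f) \<noteq> 0 \<longrightarrow> wt e + wt f = w}"

lemma weight_tensorsD: "t \<in> weight_tensors w \<Longrightarrow> wt e + wt f \<noteq> w \<Longrightarrow> Poly_Mapping.lookup t (e, f) = 0"
  by (auto simp: weight_tensors_def)

lemma homogD: "t \<in> homog par i \<Longrightarrow> par b \<noteq> i \<Longrightarrow> Poly_Mapping.lookup t b = 0"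
  by (auto simp: homog_def in_keys_iff)

lemma wt_ad_src: "ad_coef c e \<noteq> 0 \<Longrightarrow> wt (ad_src c e) = wt e - wt c"
  by (cases c; cases e) (auto simp: ad_defs split: if_splits elim!: evenE oddE)

lemma act_weight:
  assumes t: "t \<in> weight_tensors w"
  shows "act c t \<in> weight_tensors (w + wt c)"
  unfolding weight_tensors_def
proof clarify
  fix e f assume *: "Poly_Mapping.lookup (act c t) (e, f) \<noteq> 0"
  show "wt e + wt f = w + wt c"
  proof (rule ccontr)
    assume w: "wt e + wt f \<noteq> w + wt c"
    have "ad_coef c e * Poly_Mapping.lookup t (ad_src c e, f) = 0"
    proof (cases "ad_coef c e = 0")
      case False
      then show ?thesis using weight_tensorsD[OF t, of "ad_src c e" f] wt_ad_src[of c e] w by simp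
    qed simp
    moreover have "ad_coef c f * Poly_Mapping.lookup t (e, ad_src c f) = 0"
    proof (cases "ad_coef c f = 0")
      case False
      then show ?thesis using weight_tensorsD[OF t, of e "ad_src c f"] wt_ad_src[of c f] w by simp
    qed simp
    ultimately show False
      using * by (auto simp only: lookup_adj_act mult.assoc mult_zero_right add_0_left)
  qed
qed

lemma weight_tensors_diff:
  "s \<in> weight_tensors w \<Longrightarrow> t \<in> weight_tensors w \<Longrightarrow> s - t \<in> weight_tensors w"
  unfolding weight_tensors_def by (auto simp: lookup_minus) metis

lemma lookup_act_L0: "Poly_Mapping.lookup (act (L 0) t) (e, f) =
    - (of_int (wt e + wt f) / 2) * Poly_Mapping.lookup t (e, f)"
proof -
  have eq: "ad_src (L 0) e = e" "ad_coef (L 0) e = - (of_int (wt e) / 2)" for e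
    by (cases e; simp add: ad_defs field_simps)+
  show ?thesis
    unfolding lookup_adj_act eq by (simp add: field_simps)
qed

lemma ex_tensor:
  assumes "\<And>e f. g e f \<noteq> 0 \<Longrightarrow> \<bar>wt e\<bar> \<le> N \<and> \<bar>wt f\<bar> \<le> N"
  shows "\<exists>u :: (tn2_index \<times> tn2_index) vec. \<forall>e f. Poly_Mapping.lookup u (e, f) = g e f"
proof (intro exI allI)
  have "finite {p. (case p of (e, f) \<Rightarrow> g e f) \<noteq> 0}"
    by (rule finite_subset[OF _ finite_cartesian_product[OF finite_wt_bounded[of N] finite_wt_bounded[of N]]])
      (use assms in auto)
  then show "Poly_Mapping.lookup (Abs_poly_mapping (\<lambda>(e, f). g e f)) (e, f) = g e f" for e f
    by (simp add: Abs_poly_mapping_inverse)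
qed

lemma ex_tensor_bound:
  obtains N where "\<And>e f. Poly_Mapping.lookup t (e, f) \<noteq> 0 \<Longrightarrow> \<bar>wt e\<bar> \<le> N \<and> \<bar>wt f\<bar> \<le> N"
proof (rule that)
  let ?S = "(\<lambda>(e, f). max \<bar>wt e\<bar> \<bar>wt f\<bar>) ` Poly_Mapping.keys t"
  fix e f assume "Poly_Mapping.lookup t (e, f) \<noteq> 0"
  then have "max \<bar>wt e\<bar> \<bar>wt f\<bar> \<le> Max ?S"
    by (intro Max_ge) (force simp: in_keys_iff)+
  then show "\<bar>wt e\<bar> \<le> Max ?S \<and> \<bar>wt f\<bar> \<le> Max ?S" by simp
qed

definition weight_derivation where
  "weight_derivation D \<longleftrightarrow> even_derivation D \<and> (\<forall>c. D (basis c) \<in> weight_tensors (wt c))"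

lemma weight_derivation_minus_inner:
  assumes "weight_derivation D" "u \<in> homog tpar 0" "u \<in> weight_tensors 0"
  shows "weight_derivation (\<lambda>x. D x - adj_act tn2_parity tn2_bracket x u)"
  using assms even_derivation_minus_inner[of D u] act_weight[OF assms(3)]
  by (auto simp: weight_derivation_def intro!: weight_tensors_diff)

text \<open>
  Dividing each component of \<open>D(L\<^sub>0)\<close> of weight \<open>w \<noteq> 0\<close> by its eigenvalue gives \<open>r\<close> such that
  \<open>E = D - (\<lambda>x. x * r)\<close> has \<open>v' = E(L\<^sub>0)\<close> of weight \<open>0\<close>. For \<open>x\<close> of weight \<open>w\<close> the derivation rule for
  \<open>[L\<^sub>0, x]\<close> equates \<open>x * v'\<close>, which has weight \<open>w\<close>, with the image of \<open>E(x)\<close> under the operator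
  \<open>L\<^sub>0\<close> shifted by its eigenvalue in weight \<open>w\<close>. That image has no component of weight \<open>w\<close>, so
  both sides vanish: \<open>E(x)\<close> has weight \<open>w\<close>, and \<open>v'\<close> is invariant, hence \<open>0\<close>.
\<close>

lemma even_derivation_weight_reduction:
  assumes D: "even_derivation D"
  obtains r where "r \<in> homog tpar 0"
    "weight_derivation (\<lambda>x. D x - adj_act tn2_parity tn2_bracket x r)"
    "D (basis (L 0)) = act (L 0) r"
proof -
  define v where "v = D (basis (L 0))"
  obtain N where N: "\<And>e f. Poly_Mapping.lookup v (e, f) \<noteq> 0 \<Longrightarrow> \<bar>wt e\<bar> \<le> N \<and> \<bar>wt f\<bar> \<le> N"
    by (rule ex_tensor_bound[of v]) blast
  define g where "g = (\<lambda>e f. if wt e + wt f = 0 then 0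
    else - 2 / of_int (wt e + wt f) * Poly_Mapping.lookup v (e, f))"
  have "\<bar>wt e\<bar> \<le> N \<and> \<bar>wt f\<bar> \<le> N" if "g e f \<noteq> 0" for e f
    using that by (intro N) (auto simp: g_def split: if_splits)
  then obtain r where r: "\<And>e f. Poly_Mapping.lookup r (e, f) = g e f"
    using ex_tensor[of g] by metis
  have v0: "v \<in> homog tpar 0"
    using even_derivationD(5)[OF D, of "L 0"] by (simp add: v_def)
  then have r0: "r \<in> homog tpar 0"
    unfolding homog_def by (auto simp: in_keys_iff r g_def split: if_splits)
  define E where "E = (\<lambda>x. D x - adj_act tn2_parity tn2_bracket x r)"
  define v' where "v' = E (basis (L 0))"
  have E: "even_derivation E"
    unfolding E_def by (rule even_derivation_minus_inner[OF D r0])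
  have "Poly_Mapping.lookup v' (e, f) = 0" if "wt e + wt f \<noteq> 0" for e f
  proof -
    have "of_int (wt e + wt f) \<noteq> (0 :: complex)"
      using that by (simp only: of_int_eq_0_iff not_False_eq_True)
    then show ?thesis
      unfolding v'_def E_def lookup_minus lookup_act_L0 r g_def v_def by (simp add: that del: of_int_add)
  qed
  then have "v' \<in> weight_tensors 0"
    unfolding weight_tensors_def by blast
  then have wv: "act c v' \<in> weight_tensors (wt c)" for c
    using act_weight[of v' 0 c] by simp
  have key: "of_int (wt e + wt f - wt c) * Poly_Mapping.lookup (E (basis c)) (e, f)
      = - 2 * Poly_Mapping.lookup (act c v') (e, f)" for c e f
  proof -
    have "tn2_basis_bracket (L 0) c = scale (- (of_int (wt c) / 2)) (basis c)"
      by (cases c) (simp_all add: field_simps)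
    then have "scale (- (of_int (wt c) / 2)) (E (basis c)) = act (L 0) (E (basis c)) - act c v'"
      using even_derivationD(6)[OF E, of "L 0" c] even_derivationD(2,4)[OF E] by (simp add: v'_def)
    then have "Poly_Mapping.lookup (scale (- (of_int (wt c) / 2)) (E (basis c))) (e, f)
        = Poly_Mapping.lookup (act (L 0) (E (basis c)) - act c v') (e, f)"
      by simp
    then show ?thesis
      by (simp add: lookup_minus lookup_act_L0 field_simps)
  qed
  have "act c v' = 0" for c
  proof (rule poly_mapping_eqI)
    fix p :: "tn2_index \<times> tn2_index"
    obtain e f where p: "p = (e, f)" by (cases p)
    show "Poly_Mapping.lookup (act c v') p = Poly_Mapping.lookup 0 p"
    proof (cases "wt e + wt f = wt c")
      case True
      then show ?thesis using key[of e f c] by (simp add: p)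
    next
      case False
      then show ?thesis using weight_tensorsD[OF wv] by (simp add: p)
    qed
  qed
  then have v'0: "v' = 0"
    using no_invariants[of tn2_bracket v'] by (simp flip: adj_act_diag_act)
  have "wt e + wt f = wt c" if "Poly_Mapping.lookup (E (basis c)) (e, f) \<noteq> 0" for c e f
  proof -
    have "of_int (wt e + wt f - wt c) = (0 :: complex)"
      using key[of e f c] that unfolding v'0 by (simp add: act_linear del: of_int_add of_int_diff)
    then show ?thesis
      unfolding of_int_eq_0_iff by simp
  qed
  then have "E (basis c) \<in> weight_tensors (wt c)" for c
    by (simp add: weight_tensors_def)
  with E have "weight_derivation E"
    by (simp add: weight_derivation_def)
  moreover have "D (basis (L 0)) = act (L 0) r"
    using v'0 by (simp add: v'_def E_def)
  ultimately show thesis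
    using that r0 by (simp add: E_def)
qed


section \<open>Normalization on the generators\<close>

lemma odd_int_neq_0: "2 * k + (2 * l + 1) \<noteq> (0::int)" "2 * k + 1 + 2 * l \<noteq> (0::int)"
  by presburger+

text \<open>
  The image of \<open>G\<^sub>0\<close> in the odd tensors of weight \<open>0\<close> contains
  \<open>G\<^sub>0 * (G\<^sub>m \<otimes> G\<^bsub>-m\<^esub>) = 2 (L\<^sub>m \<otimes> G\<^bsub>-m\<^esub> - G\<^sub>m \<otimes> L\<^bsub>-m\<^esub>)\<close> for integers \<open>m\<close> and
  \<open>G\<^sub>0 * (T\<^sub>p \<otimes> T\<^bsub>-p\<^esub>) = - (T\<^sub>p \<otimes> G\<^bsub>-p\<^esub> + G\<^sub>p \<otimes> T\<^bsub>-p\<^esub>)\<close> for half-integers \<open>p\<close>. The coordinates of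
  \<open>G\<^sub>0 * v = 0\<close> at \<open>L \<otimes> L\<close> and at \<open>G \<otimes> G\<close> say that \<open>v\<close> is a combination of these.
\<close>

lemma act_G0_cocycle:
  assumes v: "v \<in> homog tpar 1" "v \<in> weight_tensors 0" "act (G 0) v = 0"
  obtains u where "u \<in> homog tpar 0" "u \<in> weight_tensors 0" "act (G 0) u = v"
proof -
  let ?v = "\<lambda>e f. Poly_Mapping.lookup v (e, f)"
  obtain N where N: "\<And>e f. ?v e f \<noteq> 0 \<Longrightarrow> \<bar>wt e\<bar> \<le> N \<and> \<bar>wt f\<bar> \<le> N"
    by (rule ex_tensor_bound[of v]) blast
  define g where "g e f = (case (e, f) of
      (G a, G b) \<Rightarrow> if even a \<and> even b then ?v (L (a div 2)) (G b) / 2 else 0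
    | (T k, T l) \<Rightarrow> - ?v (T k) (G (2 * l + 1))
    | _ \<Rightarrow> 0)" for e f
  have "\<bar>wt e\<bar> \<le> N \<and> \<bar>wt f\<bar> \<le> N" if "g e f \<noteq> 0" for e f
    using that by (auto simp: g_def split: tn2_index.splits if_splits dest!: N)
  then obtain u where u: "\<And>e f. Poly_Mapping.lookup u (e, f) = g e f"
    using ex_tensor[of g] by metis
  have wv: "?v e f = 0" if "wt e + wt f \<noteq> 0" for e f
    using weight_tensorsD[OF v(2) that] .
  have pv: "?v e f = 0" if "tn2_parity e = tn2_parity f" for e f
    by (rule homogD[OF v(1)]) (use that in \<open>cases "tn2_parity e"; auto simp: tensor_parity_def\<close>)
  have 1: "?v (G (2 * m)) (L n) = - ?v (L m) (G (2 * n))" for m n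
  proof -
    have "2 * ?v (G (2 * m)) (L n) + 2 * ?v (L m) (G (2 * n)) = 0"
      using arg_cong[OF v(3), of "\<lambda>t. Poly_Mapping.lookup t (L m, L n)"]
      by (simp add: lookup_adj_act ad_defs)
    then show ?thesis by algebra
  qed
  have 2: "?v (G (2 * k + 1)) (T l) = ?v (T k) (G (2 * l + 1))" for k l
    using arg_cong[OF v(3), of "\<lambda>t. Poly_Mapping.lookup t (G (2 * k + 1), G (2 * l + 1))"]
    by (simp add: lookup_adj_act ad_defs)
  have "u \<in> homog tpar 0"
    by (auto simp: homog_def in_keys_iff tensor_parity_def u g_def split: tn2_index.splits)
  moreover have "g e f = 0" if "wt e + wt f \<noteq> 0" for e f
    using that by (cases e rule: index_cases; cases f rule: index_cases; simp add: g_def wv)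
  then have "u \<in> weight_tensors 0"
    by (auto simp: weight_tensors_def u)
  moreover have "act (G 0) u = v"
  proof (rule poly_mapping_eqI, clarify)
    fix e f
    show "Poly_Mapping.lookup (act (G 0) u) (e, f) = ?v e f"
      by (cases e rule: index_cases; cases f rule: index_cases;
        simp add: lookup_adj_act ad_defs u g_def wv pv 1 2 odd_int_neq_0)
  qed
  ultimately show thesis by (rule that)
qed

text \<open>
  The tensors \<open>A\<^sub>m = 4 L\<^sub>m \<otimes> L\<^bsub>-m\<^esub> - m G\<^sub>m \<otimes> G\<^bsub>-m\<^esub>\<close> for integers \<open>m\<close> and
  \<open>B\<^sub>p = G\<^sub>p \<otimes> G\<^bsub>-p\<^esub> + p T\<^sub>p \<otimes> T\<^bsub>-p\<^esub>\<close> for half-integers \<open>p\<close> are killed by \<open>G\<^sub>0\<close>. As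
  \<open>T\<^bsub>1/2\<^esub> * A\<^sub>m\<close> has \<open>2 T\<^bsub>m+1/2\<^esub> \<otimes> L\<^bsub>-m\<^esub>\<close> as its only term in \<open>T \<otimes> L\<close>, a combination of the \<open>A\<^sub>m\<close>
  removes the coordinates of \<open>x\<close> there. Next,
  \<open>T\<^bsub>1/2\<^esub> * B\<^sub>p = G\<^bsub>p+1/2\<^esub> \<otimes> G\<^bsub>-p\<^esub> + G\<^sub>p \<otimes> G\<^bsub>1/2-p\<^esub>\<close> has one term whose first factor has an integer
  index, so the \<open>B\<^sub>p\<close> remove these coordinates without disturbing \<open>T \<otimes> L\<close>.
\<close>

lemma normalize_T0:
  assumes x: "x \<in> homog tpar 0" "x \<in> weight_tensors 1"
  obtains u where "u \<in> homog tpar 0" "u \<in> weight_tensors 0" "act (G 0) u = 0"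
    "\<forall>m n. Poly_Mapping.lookup (x - act (T 0) u) (T m, L n) = 0"
    "\<forall>m b. Poly_Mapping.lookup (x - act (T 0) u) (G (2 * m), G b) = 0"
proof -
  let ?x = "\<lambda>e f. Poly_Mapping.lookup x (e, f)"
  obtain N where N: "\<And>e f. ?x e f \<noteq> 0 \<Longrightarrow> \<bar>wt e\<bar> \<le> N \<and> \<bar>wt f\<bar> \<le> N"
    by (rule ex_tensor_bound[of x]) blast
  \<comment> \<open>\<open>K k (- k - 1)\<close> is the coefficient of \<open>B\<^sub>p\<close> in \<open>u\<close>, with \<open>p = k + 1/2\<close>. Its second summand repairs what the
    \<open>A\<^sub>m\<close>, taken with coefficient \<open>x(T\<^bsub>m+1/2\<^esub>, L\<^bsub>-m\<^esub>) / 2\<close>, add to \<open>G \<otimes> G\<close>.\<close>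
  define K where "K k l = ?x (G (2 * k + 2)) (G (2 * l + 1)) + (of_int k + 1) / 2 * ?x (T (k + 1)) (L l)" for k l
  define g where "g e f = (case (e, f) of
      (L m, L n) \<Rightarrow> 2 * ?x (T m) (L n)
    | (T k, T l) \<Rightarrow> (of_int k + 1 / 2) * K k l
    | (G a, G b) \<Rightarrow> if even a \<and> even b then - of_int (a div 2) / 2 * ?x (T (a div 2)) (L (b div 2))
        else if odd a \<and> odd b then K (a div 2) (b div 2) else 0
    | _ \<Rightarrow> 0)" for e f
  have wx: "?x e f = 0" if "wt e + wt f \<noteq> 1" for e f
    using weight_tensorsD[OF x(2) that] .
  have K0: "\<bar>2 * k + 1\<bar> \<le> N + 2 \<and> \<bar>2 * l + 1\<bar> \<le> N + 2" if "K k l \<noteq> 0" for k l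
  proof -
    have "?x (G (2 * k + 2)) (G (2 * l + 1)) \<noteq> 0 \<or> ?x (T (k + 1)) (L l) \<noteq> 0"
      using that by (auto simp: K_def)
    then show ?thesis by (auto dest!: N)
  qed
  have KN: "K k l = 0" if "k + l \<noteq> -1" for k l
    using that by (simp add: K_def wx)
  have "\<bar>wt e\<bar> \<le> N + 2 \<and> \<bar>wt f\<bar> \<le> N + 2" if "g e f \<noteq> 0" for e f
    using that by (cases e rule: index_cases; cases f rule: index_cases) (auto simp: g_def dest!: N K0)
  then obtain u where u: "\<And>e f. Poly_Mapping.lookup u (e, f) = g e f"
    using ex_tensor[of g] by metis
  have "u \<in> homog tpar 0"
    by (auto simp: homog_def in_keys_iff tensor_parity_def u g_def split: tn2_index.splits)
  moreover have "g e f = 0" if "wt e + wt f \<noteq> 0" for e f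
    using that by (cases e rule: index_cases; cases f rule: index_cases; simp add: g_def wx KN)
  then have "u \<in> weight_tensors 0"
    by (auto simp: weight_tensors_def u)
  moreover have "act (G 0) u = 0"
  proof (rule poly_mapping_eqI, clarify)
    fix e f
    have "of_int n * ?x (T m) (L n) = - (of_int m * ?x (T m) (L n))" for m n
    proof (cases "m + n = 0")
      case True
      then have "n = - m" by simp
      then show ?thesis by simp
    qed (simp add: wx)
    moreover have "of_int l * K k l = - (of_int k * K k l) - K k l" for k l
    proof (cases "k + l = - 1")
      case True
      then have l: "of_int l = (- 1 - of_int k :: complex)" by (metis add_diff_cancel_left' of_int_1 of_int_diff of_int_minus)
      show ?thesis unfolding l by (simp add: algebra_simps)
    qed (simp add: KN)
    ultimately show "Poly_Mapping.lookup (act (G 0) u) (e, f) = Poly_Mapping.lookup 0 (e, f)"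
      by (cases e rule: index_cases; cases f rule: index_cases;
        simp add: lookup_adj_act ad_defs u g_def algebra_simps)
  qed
  moreover have "Poly_Mapping.lookup (x - act (T 0) u) (T m, L n) = 0" for m n
    by (simp add: lookup_minus lookup_adj_act ad_defs u g_def)
  moreover have "Poly_Mapping.lookup (x - act (T 0) u) (G (2 * m), G b) = 0" for m b
  proof (cases "even b")
    case True
    then obtain n where "b = 2 * n" by (elim evenE)
    moreover have "2 * m + 2 * n \<noteq> 1" by presburger
    ultimately show ?thesis
      by (simp add: lookup_minus lookup_adj_act ad_defs u g_def wx)
  next
    case False
    then obtain l where "b = 2 * l + 1" by (elim oddE)
    moreover have "(2 * m - 1) div 2 = m - 1" by presburger
    ultimately show ?thesis
      by (simp add: lookup_minus lookup_adj_act ad_defs u g_def K_def)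
  qed
  ultimately show thesis using that by blast
qed

lemma constant_finite_support_eq_0:
  fixes f :: "int \<Rightarrow> complex"
  assumes "\<And>n. f n = f (n + 1)" "\<And>n. f n \<noteq> 0 \<Longrightarrow> \<bar>n\<bar> \<le> N"
  shows "f n = 0"
proof -
  have "f n = f (n + int k)" for k
  proof (induction k)
    case (Suc k)
    then show ?case using assms(1)[of "n + int k"] by (simp add: ac_simps)
  qed simp
  moreover define k where "k = nat (N + 1 + \<bar>n\<bar>)"
  then have "\<not> \<bar>n + int k\<bar> \<le> N"
    by linarith
  then have "f (n + int k) = 0"
    using assms(2) by blast
  ultimately show ?thesis
    by simp
qed

text \<open>
  Let \<open>x = D(T\<^bsub>1/2\<^esub>)\<close> and \<open>y = D(T\<^bsub>-1/2\<^esub>)\<close>, of weights \<open>1/2\<close> and \<open>-1/2\<close>. As \<open>D(G\<^sub>0) = 0\<close>, the two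
  relations between the generators become \<open>T\<^bsub>1/2\<^esub> * y = T\<^bsub>-1/2\<^esub> * x\<close> and
  \<open>T\<^bsub>1/2\<^esub> * (G\<^sub>0 * y) + G\<^bsub>-1/2\<^esub> * x = 0\<close>. In coordinates these are linear recursions for the remaining
  nonzero coordinates, which \<open>L \<otimes> T\<close>, \<open>T \<otimes> L\<close> and \<open>G \<otimes> G\<close> carry. The first relation makes the
  coordinates of \<open>y\<close> in \<open>G \<otimes> G\<close> with half-integer first index constant, hence \<open>0\<close>; together with the
  second one it does the same to the coordinates of \<open>x\<close> in \<open>L \<otimes> T\<close>. Then the second relation at
  \<open>T \<otimes> G\<close> gives the coordinates of \<open>y\<close> in \<open>G \<otimes> G\<close> with integer first index, and the first
  relation those of \<open>x\<close> in \<open>G \<otimes> G\<close>.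
\<close>

lemma normalized_derivation_eq_0:
  assumes D: "weight_derivation D" and G0: "D (basis (G 0)) = 0"
    and TL: "\<And>m n. Poly_Mapping.lookup (D (basis (T 0))) (T m, L n) = 0"
    and GG: "\<And>m b. Poly_Mapping.lookup (D (basis (T 0))) (G (2 * m), G b) = 0"
  shows "D x = 0"
proof -
  have ev: "even_derivation D"
    using D by (simp add: weight_derivation_def)
  note rule = even_derivationD[OF ev]
  define x y where "x = D (basis (T 0))" and "y = D (basis (T (- 1)))"
  define X Y where "X e f = Poly_Mapping.lookup x (e, f)" and "Y e f = Poly_Mapping.lookup y (e, f)" for e f
  have wX: "X e f = 0" if "wt e + wt f \<noteq> 1" for e f
    using weight_tensorsD[of x 1 e f] D that by (auto simp: weight_derivation_def x_def X_def dest: spec[of _ "T 0"])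
  have wY: "Y e f = 0" if "wt e + wt f \<noteq> - 1" for e f
    using weight_tensorsD[of y "- 1" e f] D that by (auto simp: weight_derivation_def y_def Y_def dest: spec[of _ "T (- 1)"])
  have pX: "X e f = 0" and pY: "Y e f = 0" if "tn2_parity e \<noteq> tn2_parity f" for e f
    unfolding X_def Y_def x_def y_def
    by (rule homogD[OF rule(5)], use that in \<open>cases "tn2_parity e"; auto simp: tensor_parity_def\<close>)+
  have TL': "X (T m) (L n) = 0" and GG': "X (G (2 * m)) (G b) = 0" for m n b
    using TL GG by (simp_all add: X_def x_def)
  obtain N where N: "\<And>e f. X e f \<noteq> 0 \<Longrightarrow> \<bar>wt e\<bar> \<le> N"
    unfolding X_def by (rule ex_wt_bound[of x]) blast
  obtain M where M: "\<And>e f. Y e f \<noteq> 0 \<Longrightarrow> \<bar>wt e\<bar> \<le> M"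
    unfolding Y_def by (rule ex_wt_bound[of y]) blast
  have "act (T 0) y - act (T (- 1)) x = 0"
    using rule(6)[of "T 0" "T (- 1)"] rule(3) by (simp add: x_def y_def)
  then have "Poly_Mapping.lookup (act (T 0) y) (e, f) = Poly_Mapping.lookup (act (T (- 1)) x) (e, f)" for e f
    by simp
  note rel1 = this[unfolded lookup_adj_act, folded X_def Y_def]
  have "D (basis (G (- 1))) = - act (G 0) y"
    using rule(6)[of "T (- 1)" "G 0"] by (simp add: G0 act_linear y_def)
  then have "- act (T 0) (act (G 0) y) = act (G (- 1)) x"
    using rule(6)[of "T 0" "G (- 1)"] by (simp add: G0 act_minus x_def)
  then have "act (T 0) (act (G 0) y) + act (G (- 1)) x = 0"
    by (metis add.right_inverse)
  then have "Poly_Mapping.lookup (act (T 0) (act (G 0) y) + act (G (- 1)) x) (e, f) = 0" for e f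
    by simp
  note rel2 = this[unfolded lookup_add lookup_adj_act, folded X_def Y_def]
  \<comment> \<open>The two letters of a name give the component in which a relation is read off: the first relation
    for \<open>TT\<close> and \<open>GG1\<close>, the second one for \<open>LG\<close>, \<open>GL\<close> and \<open>TG\<close>.\<close>
  have TT: "Y (L m) (T n) + Y (T m) (L n) = - X (L (m + 1)) (T n)" for m n
    using rel1[of "T m" "T n"] by (simp add: ad_defs TL' field_simps)
  have GG1: "Y (G (a - 1)) (G b) + Y (G a) (G (b - 1)) = X (G (a + 1)) (G b) + X (G a) (G (b + 1))" for a b
    using rel1[of "G a" "G b"] by (simp add: ad_defs)
  have half: "(2 * k - 1) div 2 = k - 1" "(k * 2 - 1) div 2 = k - 1" for k :: int
    by presburger+
  have LG: "2 * Y (G (2 * m)) (G (2 * n - 1)) - Y (L m) (T (n - 1)) - 2 * X (G (2 * m + 1)) (G (2 * n)) - X (L m) (T n) = 0" for m n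
    using rel2[of "L m" "G (2 * n)"] by (simp add: ad_defs half algebra_simps)
  have GL: "Y (T (m - 1)) (L n) + 2 * Y (G (2 * m - 1)) (G (2 * n)) = 0" for m n
    using rel2[of "G (2 * m)" "L n"] by (simp add: ad_defs TL' GG' half) (metis add.right_inverse)
  have TG: "Y (G (2 * k)) (G (2 * l + 1)) - Y (L k) (T l) / 2
    + (of_int k + 1 / 2) * Y (G (2 * k + 1)) (G (2 * l)) - of_int l / 2 * Y (T k) (L l) = 0" for k l
    using rel2[of "T k" "G (2 * l + 1)"] GG'[of "k + 1"]
    by (simp add: ad_defs TL' diff_divide_distrib algebra_simps)
  \<comment> \<open>By weights the other coordinates of \<open>x\<close> and \<open>y\<close> in \<open>G \<otimes> G\<close> vanish.\<close>
  define g where "g a = Y (G a) (G (- a - 1))" for a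
  define h where "h a = X (G a) (G (1 - a))" for a
  have rec: "g (a - 1) + g a = h (a + 1) + h a" for a
    using GG1[of a "- a"] by (simp add: g_def h_def algebra_simps)
  have h_even: "h (2 * m) = 0" for m
    by (simp add: h_def GG')
  have rec_odd: "g (2 * m) + g (2 * m + 1) = h (2 * m + 1)" for m
    using rec[of "2 * m + 1"] h_even[of "m + 1"] by (simp add: algebra_simps)
  have rec_even: "g (2 * m - 1) + g (2 * m) = h (2 * m + 1)" for m
    using rec[of "2 * m"] h_even[of m] by simp
  have g_odd: "g (2 * m - 1) = 0" for m
  proof (rule constant_finite_support_eq_0[of "\<lambda>m. g (2 * m - 1)"])
    show "g (2 * m - 1) = g (2 * (m + 1) - 1)" for m
    proof -
      have "g (2 * m - 1) = g (2 * m + 1)"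
        using rec_odd[of m] rec_even[of m] by (metis add.commute add_left_cancel)
      moreover have "2 * (m + 1) - 1 = 2 * m + 1"
        by simp
      ultimately show ?thesis
        by metis
    qed
    show "\<bar>m\<bar> \<le> M + 1" if "g (2 * m - 1) \<noteq> 0" for m
      using M[OF that[unfolded g_def]] by simp
  qed
  have g_even: "g (2 * m) = h (2 * m + 1)" for m
    using rec_even[of m] g_odd[of m] by simp
  have YLT: "Y (L m) (T (- m - 1)) = - X (L m) (T (- m))" for m
    using LG[of m "- m"] g_even[of m]
    by (simp add: g_def h_def algebra_simps) (metis eq_neg_iff_add_eq_0 add.commute)
  have YTL: "Y (T k) (L n) = 0" for k n
  proof (cases "n = - (k + 1)")
    case True
    have "Y (G (2 * (k + 1) - 1)) (G (2 * n)) = 0"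
      using g_odd[of "k + 1"] unfolding g_def True by (simp add: algebra_simps)
    then show ?thesis
      using GL[of "k + 1" n] by simp
  qed (simp add: wY)
  have XLT: "X (L m) (T (- m)) = 0" for m
  proof (rule constant_finite_support_eq_0[of "\<lambda>m. X (L m) (T (- m))"])
    show "X (L m) (T (- m)) = X (L (m + 1)) (T (- (m + 1)))" for m
      using TT[of m "- m - 1"] YLT[of m] YTL by simp
    show "\<bar>m\<bar> \<le> N" if "X (L m) (T (- m)) \<noteq> 0" for m
      using N[OF that] by simp
  qed
  have g0: "g (2 * k) = 0" for k
  proof -
    have eqs: "2 * (- k - 1) + 1 = - (2 * k) - 1" "2 * (- k - 1) = - (2 * k + 1) - 1"
      "2 * (k + 1) - 1 = 2 * k + 1"
      by simp_all
    show ?thesis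
      using TG[of k "- k - 1", unfolded eqs] g_odd[of "k + 1", unfolded eqs] YLT[of k] XLT[of k] YTL
      by (simp add: g_def minus_diff_commute)
  qed
  have XLT': "X (L m) (T n) = 0" and YLT': "Y (L m) (T n) = 0" for m n
    using XLT[of m] YLT[of m] by (cases "n = - m"; cases "n = - m - 1"; simp add: wX wY)+
  have parity: "a = 2 * (a div 2) \<or> a = 2 * (a div 2 + 1) - 1" "a = 2 * (a div 2) \<or> a = 2 * (a div 2) + 1" for a :: int
    by presburger+
  have "g a = 0" for a
    using parity(1)[of a] g0[of "a div 2"] g_odd[of "a div 2 + 1"] by metis
  then have YGG: "Y (G a) (G b) = 0" for a b
    by (cases "b = - a - 1") (simp_all add: g_def wY)
  have "h a = 0" for a
    using parity(2)[of a] h_even[of "a div 2"] g_even[of "a div 2"] g0[of "a div 2"] by metis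
  then have XGG: "X (G a) (G b) = 0" for a b
    by (cases "b = 1 - a") (simp_all add: h_def wX)
  have LL: "X (L m) (L n) = 0" "Y (L m) (L n) = 0" for m n
    by (rule wX wY; simp; presburger)+
  have TT': "X (T m) (T n) = 0" "Y (T m) (T n) = 0" for m n
    by (rule wX wY; simp; presburger)+
  have "X e f = 0" "Y e f = 0" for e f
    by (cases e; cases f; simp only: LL TT' XLT' YLT' XGG YGG TL' YTL;
        (rule pX pY; simp; fail)?)+
  then have "x = 0" "y = 0"
    by (auto intro!: poly_mapping_eqI simp: X_def Y_def)
  then show ?thesis
    using even_derivation_eq_0[OF ev] G0 by (simp add: x_def y_def)
qed

text \<open>
  The three reductions are chained: \<open>E\<close> preserves weights and kills \<open>L\<^sub>0\<close>, and \<open>F\<close> kills \<open>G\<^sub>0\<close> as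
  well. That \<open>G\<^sub>0 * E(G\<^sub>0) = 0\<close> is the derivation rule for \<open>[G\<^sub>0, G\<^sub>0] = 2 L\<^sub>0\<close>.
\<close>

theorem first_cohomology_vanishes:
  assumes D: "even_derivation D"
  obtains r where "r \<in> homog tpar 0" "\<And>x. D x = adj_act tn2_parity tn2_bracket x r"
proof -
  let ?a = "adj_act tn2_parity tn2_bracket"
  have add: "?a x (r + s) = ?a x r + ?a x s" for x r s
    by (simp add: act_linear)
  obtain r where r: "r \<in> homog tpar 0" "weight_derivation (\<lambda>x. D x - ?a x r)" "D (basis (L 0)) = act (L 0) r"
    using even_derivation_weight_reduction[OF D] .
  define E where "E = (\<lambda>x. D x - ?a x r)"
  have E: "weight_derivation E" and evE: "even_derivation E" and E0: "E (basis (L 0)) = 0"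
    using r by (simp_all add: E_def weight_derivation_def)
  note ruleE = even_derivationD[OF evE]
  have "tn2_basis_bracket (G 0) (G 0) = scale 2 (basis (L 0))"
    by simp
  then have "scale 2 (act (G 0) (E (basis (G 0)))) = 0"
    using ruleE(6)[of "G 0" "G 0"] vec.scale_left_distrib[of 1 1 "act (G 0) (E (basis (G 0)))"] E0 by (simp add: ruleE(2))
  then have "act (G 0) (E (basis (G 0))) = 0"
    by simp
  moreover have "E (basis (G 0)) \<in> homog tpar 1" "E (basis (G 0)) \<in> weight_tensors 0"
    using ruleE(5)[of "G 0"] E unfolding weight_derivation_def by (simp, metis wt.simps(3))
  ultimately obtain u where u: "u \<in> homog tpar 0" "u \<in> weight_tensors 0" "act (G 0) u = E (basis (G 0))"
    using act_G0_cocycle by metis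
  define F where "F = (\<lambda>x. E x - ?a x u)"
  have F: "weight_derivation F" and F0: "F (basis (G 0)) = 0"
    using weight_derivation_minus_inner[OF E u(1,2)] u(3) by (simp_all add: F_def)
  have T0: "F (basis (T 0)) \<in> homog tpar 0" "F (basis (T 0)) \<in> weight_tensors 1"
    using F even_derivationD(5)[of F "T 0"] unfolding weight_derivation_def
    by (simp, metis add_0 mult_zero_right wt.simps(2))
  obtain w where w: "w \<in> homog tpar 0" "w \<in> weight_tensors 0" "act (G 0) w = 0"
    "\<forall>m n. Poly_Mapping.lookup (F (basis (T 0)) - act (T 0) w) (T m, L n) = 0"
    "\<forall>m b. Poly_Mapping.lookup (F (basis (T 0)) - act (T 0) w) (G (2 * m), G b) = 0"
    using normalize_T0[OF T0] .
  have "F x - ?a x w = 0" for x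
    by (rule normalized_derivation_eq_0[OF weight_derivation_minus_inner[OF F w(1,2)]])
      (use w F0 in simp_all)
  then have "D x = ?a x (r + (u + w))" for x
    unfolding add F_def E_def by (simp add: algebra_simps)
  moreover have "r + (u + w) \<in> homog tpar 0"
    by (intro homog_subspace r u w)
  ultimately show thesis
    using that by blast
qed

theorem theorem1p2:
  fixes \<Delta> :: "tn2_index vec \<Rightarrow> (tn2_index \<times> tn2_index) vec"
  assumes "lie_super_bialgebra tn2_parity tn2_bracket \<Delta>"
  shows "\<exists>r k. r \<in> skew_tensors tn2_parity
           \<and> r \<in> homog (tensor_parity tn2_parity tn2_parity) k
           \<and> \<Delta> = coboundary tn2_parity tn2_bracket r
           \<and> cybe tn2_parity tn2_bracket r = 0"
proof -
  have lie: "lie_superalgebra tn2_parity tn2_bracket" by (rule lie_superalgebra_tn2)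
  have co: "lie_super_coalgebra tn2_parity \<Delta>"
    and cocycle: "\<And>i j x y. x \<in> homog tn2_parity i \<Longrightarrow> y \<in> homog tn2_parity j \<Longrightarrow>
      \<Delta> (tn2_bracket x y) = adj_act tn2_parity tn2_bracket x (\<Delta> y)
        - scale (zsign (i * j)) (adj_act tn2_parity tn2_bracket y (\<Delta> x))"
    using assms by (auto simp: lie_super_bialgebra_def)
  have "even_derivation \<Delta>"
    unfolding even_derivation_def
  proof (intro conjI allI)
    show "linear_map \<Delta>"
      using co by (simp add: lie_super_coalgebra_def)
    show "\<Delta> (basis c) \<in> homog tpar (tn2_parity c)" for c
      using co basis_homog[of c tn2_parity] unfolding lie_super_coalgebra_def by blast
    show "\<Delta> (tn2_basis_bracket c d) = act c (\<Delta> (basis d))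
        - scale (zsign (tn2_parity c * tn2_parity d)) (act d (\<Delta> (basis c)))" for c d
      using cocycle[OF basis_homog basis_homog, of c d] by simp
  qed
  then obtain r where r: "r \<in> homog tpar 0" and \<Delta>: "\<And>x. \<Delta> x = adj_act tn2_parity tn2_bracket x r"
    by (rule first_cohomology_vanishes) blast
  have sk: "super_twist tn2_parity (act c r) = - act c r" for c
  proof -
    have "\<Delta> (basis c) \<in> skew_tensors tn2_parity"
      using co unfolding lie_super_coalgebra_def by blast
    then show ?thesis by (simp add: \<Delta> skew_tensors_iff)
  qed
  have "act c (r + super_twist tn2_parity r) = 0" for c
    by (simp add: act_linear sk flip: super_twist_adj_act[OF lie])
  then have "r + super_twist tn2_parity r = 0"
    using no_invariants[of tn2_bracket "r + super_twist tn2_parity r"] by (simp flip: adj_act_diag_act)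
  then have rs: "super_twist tn2_parity r = - r"
    by (simp add: eq_neg_iff_add_eq_0 add.commute)
  have "diag_act tn2_parity tn2_bracket (adj_act tn2_parity tn2_bracket) (basis c) (cybe tn2_parity tn2_bracket r) = 0" for c
  proof -
    let ?u = "tensor_map id (\<lambda>x. adj_act tn2_parity tn2_bracket x r) (act c r)"
    have "\<Delta> = (\<lambda>x. adj_act tn2_parity tn2_bracket x r)"
      by (rule ext) (rule \<Delta>)
    then have "?u + super_cyclic tn2_parity ?u + super_cyclic tn2_parity (super_cyclic tn2_parity ?u) = 0"
      using co unfolding lie_super_coalgebra_def Let_def by blast
    then show ?thesis
      using co_jacobi_cybe[OF lie rs r sk refl, of c] by simp
  qed
  then have "cybe tn2_parity tn2_bracket r = 0"
    by (rule no_invariants)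
  moreover have "\<Delta> = coboundary tn2_parity tn2_bracket r"
  proof
    fix x
    show "\<Delta> x = coboundary tn2_parity tn2_bracket r x"
    proof (induction x rule: vec_induct)
      case (scale c b)
      have "coboundary tn2_parity tn2_bracket r (basis b) = act b r"
        using coboundary_homog[OF bilinear_tn2_bracket r basis_homog, of b] by simp
      then show ?case by (simp add: \<Delta> act_linear coboundary_def)
    qed (simp_all add: \<Delta> act_linear coboundary_def)
  qed
  ultimately show ?thesis
    using r rs skew_tensors_iff by blast
qed

end
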